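(* Let $\alpha$ be a positive integer and $F(z)=1+\sum_{\lambda\ge1}f_\lambda z^\lambda$. Then there is a polynomial $P_\alpha(z)\in\mathbb{Z}[z]$ such that $F(z)\equiv P_\alpha(z)/(1+2z)^\alpha$ coefficientwise modulo $7^\alpha$. In particular, the sequence $(f_\lambda)_{\lambda\ge1}$ reduced modulo $7^\alpha$ is ultimately periodic, with minimal period equal to $6\cdot7^{\alpha-1}$.
   Context: $f_\lambda$ denotes the number of free subgroups of index $6\lambda$ in the modular group $\mathrm{PSL}_2(\mathbb{Z})\cong C_2*C_3$. "$F\equiv P/(1+2z)^\alpha$ modulo $7^\alpha$" means that the coefficients of $F(z)$ and of the power series $P(z)(1+2z)^{-\alpha}$ agree modulo $7^\alpha$. *)

theory Defs
  imports
    "HOL-Analysis.Determinants"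
    "HOL-Algebra.Generated_Groups"
    "HOL-Computational_Algebra.Polynomial_FPS"
    "HOL-Number_Theory.Cong"
begin

definition SL2Z :: "(int^2^2) monoid" where
  "SL2Z = \<lparr>carrier = {A. det A = 1}, monoid.mult = (**), one = mat 1\<rparr>"

definition PSL2Z :: "(int^2^2) set monoid" where
  "PSL2Z = SL2Z Mod {mat 1, - mat 1}"

text \<open>
  A word over \<open>X\<close> is a list of pairs whose second component lies in \<open>X\<close>; the letter
  \<open>(True, x)\<close> stands for \<open>x\<close> and \<open>(False, x)\<close> for its formal inverse.
\<close>

definition reduced_word :: "(bool \<times> 'a) list \<Rightarrow> bool" where
  "reduced_word = successively (\<lambda>(b, x) (c, y). \<not> (x = y \<and> b \<noteq> c))"

definition word_value :: "('a, 'b) monoid_scheme \<Rightarrow> (bool \<times> 'a) list \<Rightarrow> 'a" where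
  "word_value G w =
     foldr (\<lambda>(b, x) g. (if b then x else inv\<^bsub>G\<^esub> x) \<otimes>\<^bsub>G\<^esub> g) w \<one>\<^bsub>G\<^esub>"

definition free_basis :: "('a, 'b) monoid_scheme \<Rightarrow> 'a set \<Rightarrow> bool" where
  "free_basis G X \<longleftrightarrow>
     X \<subseteq> carrier G \<and> generate G X = carrier G \<and>
     (\<forall>w \<in> lists (UNIV \<times> X). reduced_word w \<longrightarrow> w \<noteq> [] \<longrightarrow> word_value G w \<noteq> \<one>\<^bsub>G\<^esub>)"

definition free_group :: "('a, 'b) monoid_scheme \<Rightarrow> bool" where
  "free_group G \<longleftrightarrow> group G \<and> (\<exists>X. free_basis G X)"

text \<open>
  Since \<open>card\<close> of an infinite set is \<open>0\<close>, the condition on the index has the intended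
  meaning for \<open>\<lambda> \<ge> 1\<close> only; the value at \<open>\<lambda> = 0\<close> is never used.
\<close>

definition num_free_subgroups :: "nat \<Rightarrow> nat" where
  "num_free_subgroups l =
     card {H. subgroup H PSL2Z \<and> free_group (PSL2Z\<lparr>carrier := H\<rparr>) \<and>
              card (rcosets\<^bsub>PSL2Z\<^esub> H) = 6 * l}"

definition free_subgroup_fps :: "int fps" where
  "free_subgroup_fps =
     Abs_fps (\<lambda>l. if l = 0 then 1 else int (num_free_subgroups l))"

definition fps_coeffs_cong :: "int fps \<Rightarrow> int fps \<Rightarrow> int \<Rightarrow> bool" where
  "fps_coeffs_cong A B m \<longleftrightarrow> (\<forall>n. [fps_nth A n = fps_nth B n] (mod m))"

text \<open>
  The type \<^typ>\<open>int fps\<close> has no division.  If \<open>Q\<close> has constant term \<open>1\<close>, then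
  \<open>fps_right_inverse Q 1\<close> is its inverse, so \<open>fps_quot P Q\<close> is the power series \<open>P / Q\<close>.
\<close>

definition fps_quot :: "int fps \<Rightarrow> int fps \<Rightarrow> int fps" where
  "fps_quot P Q = P * fps_right_inverse Q 1"

lemma fps_quot_mult:
  assumes "fps_nth Q 0 = 1"
  shows "fps_quot P Q * Q = P"
  using fps_right_inverse[of Q 1] assms by (simp add: fps_quot_def mult_ac)

definition ultimate_period :: "(nat \<Rightarrow> 'a) \<Rightarrow> nat \<Rightarrow> bool" where
  "ultimate_period s p \<longleftrightarrow> p > 0 \<and> (\<exists>N. \<forall>n\<ge>N. s (n + p) = s n)"

definition ultimately_periodic :: "(nat \<Rightarrow> 'a) \<Rightarrow> bool" where
  "ultimately_periodic s \<longleftrightarrow> (\<exists>p. ultimate_period s p)"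

definition minimal_period :: "(nat \<Rightarrow> 'a) \<Rightarrow> nat" where
  "minimal_period s = (LEAST p. ultimate_period s p)"

end

theory Submission
  imports Defs "HOL-Number_Theory.Residue_Primitive_Roots"
begin

text \<open>
  A subgroup of index \<open>n\<close> of \<open>C\<^sub>2 * C\<^sub>3\<close> is free iff both generators act on its cosets without
  fixed points.  Sorting the pairs of a fixed-point-free involution and a fixed-point-free
  permutation of order 3 on \<open>n\<close> points by the stabilizer of a point gives
  \<open>6 \<lambda> h\<^sub>\<lambda> = \<Sum> f\<^sub>\<mu> h\<^bsub>\<lambda> - \<mu>\<^esub>\<close>, where \<open>h\<^sub>\<lambda> (6 \<lambda>)!\<close> is the number of such pairs on \<open>6 \<lambda>\<close> points.
  As \<open>h\<close> is hypergeometric, \<open>F\<close> satisfies the Riccati equation \<open>F - 1 = z (6 z F' + 4 F + F\<^sup>2)\<close>.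

  Modulo \<open>7\<^sup>\<alpha>\<close> the parameter \<open>1/6\<close> of the hypergeometric equation may be replaced by \<open>- N\<close>
  with \<open>N = (7\<^sup>\<alpha> - 1) / 6\<close>.  The perturbed equation has a polynomial solution \<open>Y\<close>, a Bessel
  polynomial, with constant term 1, whence \<open>F Y \<equiv> Y + 6 z Y'\<close>.  Since \<open>N \<equiv> 1\<close> modulo 7, moreover
  \<open>Y \<equiv> 1 + 2 z\<close> modulo 7, so \<open>Y\<close> divides \<open>(1 + 2 z)\<^sup>\<alpha>\<close> modulo \<open>7\<^sup>\<alpha>\<close>.  The period is the order of
  \<open>z\<close> modulo \<open>Y\<close> and \<open>7\<^sup>\<alpha>\<close>, that is, the order of the root of \<open>Y\<close> in the residues modulo
  \<open>7\<^sup>\<alpha>\<close>.  It is congruent to 3 modulo 49 (modulo 7 if \<open>\<alpha> = 1\<close>),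
  hence a primitive root.
\<close>

section \<open>Words in the free product of two cyclic groups of orders two and three\<close>

text \<open>The coefficients of the hypergeometric series have ratio
  \<open>(6 l + 1) (6 l + 5) / (6 (l + 1))\<close>. Dividing by \<open>l + 1\<close> loses powers of
  7, so congruent parameters do not give congruent coefficients. Hence the perturbation is made in
  the Riccati equation: with \<open>V = F - 1\<close>, the defect \<open>V Y - 6 z Y'\<close> obeys
  a recurrence without division. The parameters 1/6 and 5/6 are replaced by \<open>- N\<close> and
  \<open>N + 1\<close>; their sum stays 1, so only one coefficient of the differential equation
  changes, and the series terminates.

  On the group side, the modular group is given by matrices. It is recognised as a free product
  through relations, generation and faithful normal forms; these turn any two permutations that
  satisfy the relations into an action. The harder half of the freeness criterion rests on such an
  action as well: Schreier transversals are combined with van der Waerden's trick of letting the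
  group permute reduced words.\<close>

primrec word_act :: "('x \<Rightarrow> 'x) \<Rightarrow> ('x \<Rightarrow> 'x) \<Rightarrow> bool list \<Rightarrow> 'x \<Rightarrow> 'x" where
  "word_act s u [] x = x"
| "word_act s u (b # w) x = word_act s u w (if b then s x else u x)"

lemma word_act_append [simp]:
  "word_act s u (v @ w) x = word_act s u w (word_act s u v x)"
  by (induction v arbitrary: x) auto

text \<open>The normal form \<open>U\<^sup>a (S U\<^sup>e) \<dots> (S U\<^sup>e) S\<^sup>b\<close>; an exponent \<open>e\<close> is \<open>2\<close> or \<open>1\<close>
  according to the entry of \<open>es\<close>.\<close>

definition nf_word :: "nat \<Rightarrow> bool list \<Rightarrow> bool \<Rightarrow> bool list" where
  "nf_word a es b = replicate a False @
     concat (map (\<lambda>e. True # replicate (if e then 2 else 1) False) es) @ (if b then [True] else [])"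

text \<open>Words have no inverse letters: \<open>S\<close> is its own inverse and
  \<open>U U\<close> is the inverse of \<open>U\<close>.\<close>

definition word_inv :: "bool list \<Rightarrow> bool list" where
  "word_inv w = concat (rev (map (\<lambda>b. if b then [True] else [False, False]) w))"

lemma word_inv_simps [simp]:
  "word_inv [] = []"
  "word_inv (b # w) = word_inv w @ (if b then [True] else [False, False])"
  by (simp_all add: word_inv_def)

definition word_eval :: "('a, 'b) monoid_scheme \<Rightarrow> 'a \<Rightarrow> 'a \<Rightarrow> bool list \<Rightarrow> 'a" where
  "word_eval G S U w = foldr (\<lambda>b g. (if b then S else U) \<otimes>\<^bsub>G\<^esub> g) w \<one>\<^bsub>G\<^esub>"

text \<open>The relations are demanded on \<open>X\<close> only, so that maps such as
  \<open>C #> S\<close>, which are not controlled outside the set of cosets, qualify.\<close>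

definition act23 :: "'x set \<Rightarrow> ('x \<Rightarrow> 'x) \<Rightarrow> ('x \<Rightarrow> 'x) \<Rightarrow> bool" where
  "act23 X s u \<longleftrightarrow> (\<forall>x\<in>X. s x \<in> X \<and> u x \<in> X \<and> s (s x) = x \<and> u (u (u x)) = x)"

lemma act23_word_act: "act23 X s u \<Longrightarrow> x \<in> X \<Longrightarrow> word_act s u w x \<in> X"
  by (induction w arbitrary: x) (auto simp: act23_def)

lemma act23_word_inv:
  assumes "act23 X s u" "x \<in> X"
  shows "word_act s u (word_inv w) (word_act s u w x) = x"
  using assms(2)
proof (induction w arbitrary: x)
  case (Cons b w)
  then show ?case using assms(1) by (auto simp: act23_def)
qed simp

lemma act23_word_inv':
  assumes "act23 X s u" "x \<in> X"
  shows "word_act s u w (word_act s u (word_inv w) x) = x"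
  using assms(2)
proof (induction w arbitrary: x)
  case (Cons b w)
  have "word_act s u (word_inv w) x \<in> X" by (intro act23_word_act assms Cons)
  then show ?case using Cons assms(1) by (auto simp: act23_def)
qed simp

text \<open>Every word can be brought to normal form by the two relations alone. Faithfulness of
  normal forms therefore says that no further relation holds, which characterises the free product
  without constructing it.\<close>

locale free_product_2_3 = group G for G (structure) +
  fixes S U
  assumes S_closed [simp]: "S \<in> carrier G"
    and U_closed [simp]: "U \<in> carrier G"
    and S_square: "S \<otimes> S = \<one>"
    and U_cube: "U \<otimes> (U \<otimes> U) = \<one>"
    and generated: "g \<in> carrier G \<Longrightarrow> \<exists>w. word_eval G S U w = g"
    and nf_faithful: "a < 3 \<Longrightarrow> word_eval G S U (nf_word a es b) = \<one> \<Longrightarrow> nf_word a es b = []"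
begin

abbreviation ev :: "bool list \<Rightarrow> 'a" where "ev \<equiv> word_eval G S U"

lemma ev_simps [simp]: "ev [] = \<one>" "ev (b # w) = (if b then S else U) \<otimes> ev w"
  by (simp_all add: word_eval_def)

lemma ev_closed [simp]: "ev w \<in> carrier G"
  by (induction w) auto

lemma ev_append [simp]: "ev (v @ w) = ev v \<otimes> ev w"
  by (induction v) (auto simp: m_assoc)

lemma S_cancel: "g \<in> carrier G \<Longrightarrow> S \<otimes> (S \<otimes> g) = g"
  by (simp add: S_square flip: m_assoc)

lemma U_cancel: "g \<in> carrier G \<Longrightarrow> U \<otimes> (U \<otimes> (U \<otimes> g)) = g"
  using U_cube by (simp flip: m_assoc)

lemma ev_word_inv [simp]: "ev (word_inv w) = inv (ev w)"
proof (induction w)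
  case (Cons b w)
  have "inv S = S" using S_square by (simp add: inv_equality)
  moreover have "inv U = U \<otimes> U"
    using U_cube by (intro inv_equality) (auto simp: m_assoc)
  ultimately show ?case using Cons by (auto simp: inv_mult_group)
qed simp

text \<open>Rewriting uses nothing but the two relations, which hold both in \<open>G\<close> and
  for the maps on \<open>X\<close>. One normal form thus serves both sides, and this transfers
  equalities in \<open>G\<close> to the action.\<close>

lemma nf_exists:
  assumes "act23 X s u"
  shows "\<exists>a es b. a < 3 \<and> ev w = ev (nf_word a es b) \<and>
           (\<forall>x\<in>X. word_act s u w x = word_act s u (nf_word a es b) x)"
proof (induction w)
  case Nil
  show ?case by (intro exI[of _ 0] exI[of _ "[]"] exI[of _ False]) (simp add: nf_word_def)
next
  case (Cons l w)
  let ?eq = "\<lambda>v w. ev v = ev w \<and> (\<forall>x\<in>X. word_act s u v x = word_act s u w x)"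
  obtain a es b where nf: "a < 3" "?eq w (nf_word a es b)" using Cons by blast
  have lw: "?eq (l # w) (l # nf_word a es b)"
    using nf assms by (auto simp: act23_def)
  have nfI: "\<exists>a' es' b'. a' < 3 \<and> ?eq v (nf_word a' es' b')"
    if "c < 3" "?eq v (nf_word c fs d)" for v c fs d
    using that by blast
  have "\<exists>a' es' b'. a' < 3 \<and> ?eq (l # nf_word a es b) (nf_word a' es' b')"
  proof (cases l)
    case False
    show ?thesis
    proof (cases "a = 2")
      case True
      have "?eq (l # nf_word a es b) (nf_word 0 es b)"
        using False True assms by (auto simp: nf_word_def numeral_2_eq_2 U_cancel act23_def)
      then show ?thesis by (rule nfI[rotated]) simp
    next
      case a: False
      then have "Suc a < 3" "l # nf_word a es b = nf_word (Suc a) es b"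
        using nf(1) False by (auto simp: nf_word_def)
      then show ?thesis using nfI[of "Suc a" "l # nf_word a es b" es b] by simp
    qed
  next
    case True
    consider "a > 0" | "a = 0" "es = []" "b" | "a = 0" "es = []" "\<not> b" | e es' where "a = 0" "es = e # es'"
      by (cases es) auto
    then show ?thesis
    proof cases
      case 1
      then have "l # nf_word a es b = nf_word 0 ((a = 2) # es) b"
        using nf(1) True by (cases "a = 2") (auto simp: nf_word_def numeral_2_eq_2 numeral_3_eq_3 less_Suc_eq)
      then show ?thesis using nfI[of 0 "l # nf_word a es b" "(a = 2) # es" b] by simp
    next
      case 2
      then have "?eq (l # nf_word a es b) (nf_word 0 [] False)"
        using True assms by (auto simp: nf_word_def S_square act23_def)
      then show ?thesis by (rule nfI[rotated]) simp
    next
      case 3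
      then have "l # nf_word a es b = nf_word 0 [] True"
        using True by (auto simp: nf_word_def)
      then show ?thesis using nfI[of 0 "l # nf_word a es b" "[]" True] by simp
    next
      case 4
      \<comment> \<open>The new \<open>S\<close> cancels against that of the first syllable, whose
        power of \<open>U\<close> becomes the leading one.\<close>
      then have "?eq (l # nf_word a es b) (nf_word (if e then 2 else 1) es' b)"
        using True assms by (auto simp: nf_word_def S_cancel act23_def)
      moreover have "(if e then 2 else 1 :: nat) < 3" by simp
      ultimately show ?thesis by (rule nfI[rotated])
    qed
  qed
  then obtain a' es' b' where "a' < 3" "?eq (l # nf_word a es b) (nf_word a' es' b')" by blast
  then show ?case using lw nfI[of a' "l # w" es' b'] by simp
qed

text \<open>The universal property of the free product: every pair \<open>s\<close>, \<open>u\<close> satisfying the two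
  relations defines an action of \<open>G\<close>.\<close>

lemma word_act_cong:
  assumes act: "act23 X s u" and x: "x \<in> X" and eq: "ev v = ev w"
  shows "word_act s u v x = word_act s u w x"
proof -
  \<comment> \<open>Passing to \<open>word_inv v @ w\<close> reduces the comparison of two words to
    the triviality of one, which is what \<open>nf_faithful\<close> decides.\<close>
  obtain a es b where nf: "a < 3" "ev (word_inv v @ w) = ev (nf_word a es b)"
    "\<forall>x\<in>X. word_act s u (word_inv v @ w) x = word_act s u (nf_word a es b) x"
    using nf_exists[OF act] by blast
  have "ev (word_inv v @ w) = \<one>" by (simp add: eq)
  then have "nf_word a es b = []" using nf nf_faithful by metis
  then have "word_act s u (word_inv v @ w) (word_act s u v x) = word_act s u v x"
    using nf(3) act23_word_act[OF act x] by simp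
  then show ?thesis by (simp add: act23_word_inv[OF act x])
qed

section \<open>Right cosets as an action, and stabilizers as subgroups\<close>

lemma word_act_rcoset:
  assumes "H \<subseteq> carrier G" "g \<in> carrier G"
  shows "word_act (\<lambda>C. C #> S) (\<lambda>C. C #> U) w (H #> g) = H #> (g \<otimes> ev w)"
  using assms(2) by (induction w arbitrary: g) (auto simp: coset_mult_assoc assms(1) m_assoc)

lemma rcosets_eq: "rcosets H = range (\<lambda>w. H #> ev w)"
  using generated by (fastforce simp: RCOSETS_def)

lemma act23_rcosets:
  assumes "H \<subseteq> carrier G"
  shows "act23 (rcosets H) (\<lambda>C. C #> S) (\<lambda>C. C #> U)"
proof -
  have "H #> ev w #> S = H #> ev (w @ [True])" "H #> ev w #> U = H #> ev (w @ [False])" for w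
    by (simp_all add: coset_mult_assoc assms)
  moreover have "H #> ev w #> S #> S = H #> ev w" "H #> ev w #> U #> U #> U = H #> ev w" for w
    by (simp_all add: coset_mult_assoc assms m_assoc S_square U_cube)
  ultimately show ?thesis unfolding act23_def rcosets_eq by (auto simp del: ev_append)
qed

text \<open>The action of \<open>G\<close> is available only through words, so the stabilizer
  collects values of words. That membership does not depend on the word chosen is
  \<open>word_act_cong\<close>.\<close>

definition stab :: "('x \<Rightarrow> 'x) \<Rightarrow> ('x \<Rightarrow> 'x) \<Rightarrow> 'x \<Rightarrow> 'a set" where
  "stab s u x = {ev w | w. word_act s u w x = x}"

lemma ev_in_stab_iff:
  assumes "act23 X s u" "x \<in> X"
  shows "ev w \<in> stab s u x \<longleftrightarrow> word_act s u w x = x"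
proof
  assume "ev w \<in> stab s u x"
  then obtain v where "ev w = ev v" "word_act s u v x = x" by (auto simp: stab_def)
  then show "word_act s u w x = x" using word_act_cong[OF assms, of w v] by simp
qed (auto simp: stab_def)

lemma subgroup_stab:
  assumes "act23 X s u" "x \<in> X"
  shows "subgroup (stab s u x) G"
proof (rule subgroupI)
  show "stab s u x \<subseteq> carrier G" by (auto simp: stab_def)
  show "stab s u x \<noteq> {}" using ev_in_stab_iff[OF assms, of "[]"] by auto
next
  fix a assume "a \<in> stab s u x"
  then obtain w where w: "a = ev w" "word_act s u w x = x" by (auto simp: stab_def)
  then show "inv a \<in> stab s u x"
    using act23_word_inv[OF assms, of w] ev_in_stab_iff[OF assms, of "word_inv w"] by simp
next
  fix a b assume "a \<in> stab s u x" "b \<in> stab s u x"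
  then obtain v w where "a = ev v" "word_act s u v x = x" "b = ev w" "word_act s u w x = x"
    by (auto simp: stab_def)
  then show "a \<otimes> b \<in> stab s u x" using ev_in_stab_iff[OF assms, of "v @ w"] by simp
qed

lemma rcoset_eq_iff:
  assumes "subgroup H G" "a \<in> carrier G" "b \<in> carrier G"
  shows "H #> a = H #> b \<longleftrightarrow> a \<otimes> inv b \<in> H"
proof -
  have H: "H \<subseteq> carrier G" using assms(1) by (rule subgroup.subset)
  have "H #> a = H #> b \<longleftrightarrow> H #> (a \<otimes> inv b) = H"
    using assms H by (metis coset_mult_assoc coset_mult_inv1 coset_mult_inv2 inv_closed coset_mult_one r_inv)
  also have "\<dots> \<longleftrightarrow> a \<otimes> inv b \<in> H"
    using assms by (metis coset_join1 coset_join2 H inv_closed m_closed)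
  finally show ?thesis .
qed

text \<open>The orbit-stabilizer correspondence, phrased with words.\<close>

lemma rcoset_stab_eq_iff:
  assumes "act23 X s u" "x \<in> X"
  shows "stab s u x #> ev v = stab s u x #> ev w \<longleftrightarrow> word_act s u v x = word_act s u w x"
proof -
  have "stab s u x #> ev v = stab s u x #> ev w \<longleftrightarrow> ev (v @ word_inv w) \<in> stab s u x"
    using rcoset_eq_iff[OF subgroup_stab[OF assms]] by simp
  also have "\<dots> \<longleftrightarrow> word_act s u (word_inv w) (word_act s u v x) = x"
    by (simp add: ev_in_stab_iff[OF assms] del: ev_append)
  also have "\<dots> \<longleftrightarrow> word_act s u v x = word_act s u w x"
    using act23_word_inv[OF assms] act23_word_inv'[OF assms(1) act23_word_act[OF assms]] by metis
  finally show ?thesis .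
qed

end

section \<open>Bases of free groups\<close>

lemma word_value_Nil [simp]: "word_value G [] = \<one>\<^bsub>G\<^esub>"
  and word_value_Cons [simp]: "word_value G ((b, x) # w) =
    (if b then x else inv\<^bsub>G\<^esub> x) \<otimes>\<^bsub>G\<^esub> word_value G w"
  by (simp_all add: word_value_def)

lemma reduced_word_append_iff:
  "reduced_word (v @ w) \<longleftrightarrow> reduced_word v \<and> reduced_word w \<and>
     (v = [] \<or> w = [] \<or> \<not> (snd (last v) = snd (hd w) \<and> fst (last v) \<noteq> fst (hd w)))"
  by (auto simp: reduced_word_def successively_append_iff case_prod_beta)

lemma reduced_word_Cons_iff:
  "reduced_word (l # w) \<longleftrightarrow> reduced_word w \<and>
     (w = [] \<or> \<not> (snd l = snd (hd w) \<and> fst l \<noteq> fst (hd w)))"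
  by (auto simp: reduced_word_def successively_Cons case_prod_beta)

lemma reduced_word_simps [simp]: "reduced_word []" "reduced_word [l]"
  by (simp_all add: reduced_word_def)

context group
begin

lemma word_value_closed:
  assumes "X \<subseteq> carrier G" "w \<in> lists (UNIV \<times> X)"
  shows "word_value G w \<in> carrier G"
  using assms(2)
proof (induction w)
  case (Cons l w)
  then show ?case using assms(1) by (cases l) auto
qed simp

lemma word_value_append:
  assumes "X \<subseteq> carrier G" "v \<in> lists (UNIV \<times> X)" "w \<in> lists (UNIV \<times> X)"
  shows "word_value G (v @ w) = word_value G v \<otimes> word_value G w"
  using assms(2)
proof (induction v)
  case (Cons l v)
  then show ?case using assms(1) word_value_closed[OF assms(1)] assms(3)
    by (cases l) (auto simp: m_assoc subset_iff)
qed (use word_value_closed[OF assms(1,3)] in simp)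

text \<open>A new left letter either leaves the word reduced or cancels its first letter, and the
  tail of a reduced word is reduced. \<open>mult\<close> iterates this to cover products.\<close>

lemma generate_imp_reduced_word:
  assumes X: "X \<subseteq> carrier G" and g: "g \<in> generate G X"
  shows "\<exists>w\<in>lists (UNIV \<times> X). reduced_word w \<and> word_value G w = g"
proof -
  have step: "\<exists>w'\<in>lists (UNIV \<times> X). reduced_word w' \<and>
      word_value G w' = (if b then x else inv x) \<otimes> word_value G w"
    if w: "w \<in> lists (UNIV \<times> X)" "reduced_word w" and x: "x \<in> X" for b x w
  proof (cases "reduced_word ((b, x) # w)")
    case True
    then show ?thesis using w x by (intro bexI[of _ "(b, x) # w"]) auto
  next
    case False
    then obtain w' where w': "w = (\<not> b, x) # w'"
      using w(2) by (cases w) (auto simp: reduced_word_Cons_iff)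
    have "x \<in> carrier G" "word_value G w' \<in> carrier G"
      using x w X w' word_value_closed[OF X, of w'] by auto
    then have "(if b then x else inv x) \<otimes> word_value G w = word_value G w'"
      by (auto simp: w' simp flip: m_assoc)
    then show ?thesis using w w' by (intro bexI[of _ w']) (auto simp: reduced_word_Cons_iff)
  qed
  have mult: "\<exists>w'\<in>lists (UNIV \<times> X). reduced_word w' \<and> word_value G w' = word_value G v \<otimes> word_value G w"
    if "v \<in> lists (UNIV \<times> X)" "w \<in> lists (UNIV \<times> X)" "reduced_word w" for v w
    using that(1)
  proof (induction v)
    case Nil
    then show ?case using that word_value_closed[OF X that(2)] by auto
  next
    case (Cons l v)
    obtain b x where l: "l = (b, x)" by (cases l)
    obtain w' where w': "w'\<in>lists (UNIV \<times> X)" "reduced_word w'"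
        "word_value G w' = word_value G v \<otimes> word_value G w"
      using Cons by auto
    obtain w'' where "w''\<in>lists (UNIV \<times> X)" "reduced_word w''"
        "word_value G w'' = (if b then x else inv x) \<otimes> word_value G w'"
      using step[OF w'(1,2), of x b] Cons l by auto
    moreover have "x \<in> carrier G" using Cons l X by auto
    ultimately show ?case using w'(3) word_value_closed[OF X that(2)] word_value_closed[OF X, of v] Cons l
      by (intro bexI[of _ w'']) (auto simp: m_assoc)
  qed
  show ?thesis using g
  proof (induction rule: generate.induct)
    case one
    then show ?case by (intro bexI[of _ "[]"]) auto
  next
    case (incl h)
    then show ?case using X by (intro bexI[of _ "[(True, h)]"]) auto
  next
    case (inv h)
    then show ?case using X by (intro bexI[of _ "[(False, h)]"]) auto
  next
    case (eng h1 h2)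
    then show ?case using mult by metis
  qed
qed

text \<open>Conjugating by the first letter makes the word cyclically reduced; powers of a cyclically
  reduced word are reduced.\<close>

lemma free_basis_torsion_free:
  fixes n :: nat
  assumes basis: "free_basis G X" and g: "g \<in> carrier G" and n: "n > 0" "g [^] n = \<one>"
  shows "g = \<one>"
proof -
  have X: "X \<subseteq> carrier G" and gen: "generate G X = carrier G"
    and free: "\<And>w. w \<in> lists (UNIV \<times> X) \<Longrightarrow> reduced_word w \<Longrightarrow> w \<noteq> [] \<Longrightarrow> word_value G w \<noteq> \<one>"
    using basis by (auto simp: free_basis_def)
  have "word_value G w [^] n \<noteq> \<one>"
    if "w \<in> lists (UNIV \<times> X)" "reduced_word w" "w \<noteq> []" for w
    using that
  proof (induction "length w" arbitrary: w rule: less_induct)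
    case (less w)
    show ?case
    proof (cases "snd (last w) = snd (hd w) \<and> fst (last w) \<noteq> fst (hd w)")
      case False
      have red: "reduced_word (concat (replicate k w))" for k
      proof (induction k)
        case (Suc k)
        have "concat (replicate k w) = [] \<or> hd (concat (replicate k w)) = hd w"
          using less by (cases k) auto
        then show ?case using less False Suc by (auto simp: reduced_word_append_iff)
      qed simp
      have "concat (replicate k w) \<in> lists (UNIV \<times> X) \<and>
          word_value G (concat (replicate k w)) = word_value G w [^] k" for k
      proof (induction k)
        case (Suc k)
        have "word_value G w [^] Suc k = word_value G w \<otimes> word_value G w [^] k"
          using less by (intro nat_pow_Suc2 word_value_closed[OF X])
        then show ?case using less Suc word_value_append[OF X, of w "concat (replicate k w)"]
          by auto
      qed simp
      moreover have "concat (replicate n w) \<noteq> []" using n less by auto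
      ultimately show ?thesis using free[OF _ red[of n]] by metis
    next
      case True
      obtain b x where hd: "hd w = (b, x)" by (cases "hd w")
      then have last: "last w = (\<not> b, x)" using True by (cases "last w") auto
      have w: "w = (b, x) # tl w" using hd less by (metis list.collapse)
      have "tl w \<noteq> []" using w last by (metis last.simps prod.inject)
      then obtain v where v: "w = (b, x) # v @ [(\<not> b, x)]"
        using w last by (metis append_butlast_last_id last_ConsR)
      have "v \<noteq> []" using less(3) v by (auto simp: reduced_word_Cons_iff)
      moreover have "reduced_word v" using less(3) v by (auto simp: reduced_word_Cons_iff reduced_word_append_iff)
      moreover have v_lists: "v \<in> lists (UNIV \<times> X)" using less(2) v by auto
      ultimately have IH: "word_value G v [^] n \<noteq> \<one>" using less(1)[of v] v by auto
      define y where "y = (if b then x else inv x)"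
      have x: "x \<in> carrier G" using less(2) v X by auto
      then have y: "y \<in> carrier G" "(if \<not> b then x else inv x) = inv y" by (auto simp: y_def)
      have vc: "word_value G v \<in> carrier G" using word_value_closed[OF X v_lists] .
      have "word_value G w = y \<otimes> (word_value G v \<otimes> inv y)"
        using word_value_append[OF X v_lists, of "[(\<not> b, x)]"] less(2) v x y
        by (auto simp: y_def)
      then have "word_value G w [^] k = y \<otimes> (word_value G v [^] k \<otimes> inv y)" for k :: nat
      proof (induction k)
        case (Suc k)
        have "inv y \<otimes> (y \<otimes> (word_value G v \<otimes> inv y)) = word_value G v \<otimes> inv y"
          using y vc by (simp flip: m_assoc)
        then show ?case using Suc y vc by (simp add: m_assoc)
      qed (use y in simp)
      moreover have "y \<otimes> (z \<otimes> inv y) = \<one> \<longrightarrow> z = \<one>" if "z \<in> carrier G" for z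
        using that y by (metis inv_closed inv_equality inv_inv l_cancel_one' m_assoc m_closed r_inv r_one inv_solve_left)
      ultimately show ?thesis using IH vc by (metis nat_pow_closed)
    qed
  qed
  moreover obtain w where "w \<in> lists (UNIV \<times> X)" "reduced_word w" "word_value G w = g"
    using generate_imp_reduced_word[OF X, of g] g gen by auto
  ultimately show ?thesis using n by (cases "w = []") auto
qed

end

section \<open>Free subgroups are those acting freely on cosets\<close>

text \<open>Words are multiplied on the right, so the list stores them in reverse.\<close>

definition push_letter :: "bool \<times> 'x \<Rightarrow> (bool \<times> 'x) list \<Rightarrow> (bool \<times> 'x) list" where
  "push_letter l w =
     (if w \<noteq> [] \<and> snd (hd w) = snd l \<and> fst (hd w) \<noteq> fst l then tl w else l # w)"

lemma reduced_word_push_letter: "reduced_word w \<Longrightarrow> reduced_word (push_letter l w)"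
  by (cases w) (auto simp: push_letter_def reduced_word_Cons_iff)

text \<open>Letters act as permutations of the reduced words. Reducedness matters: if
  \<open>w\<close> began with a letter followed by its inverse, a second cancellation would
  occur.\<close>

lemma push_letter_cancel:
  "reduced_word w \<Longrightarrow> push_letter (b, x) (push_letter (\<not> b, x) w) = w"
  "reduced_word w \<Longrightarrow> push_letter (\<not> b, x) (push_letter (b, x) w) = w"
  by (cases w; cases "tl w"; force simp: push_letter_def reduced_word_Cons_iff)+

lemma fold_push_letter_reduced:
  "reduced_word (rev v @ w) \<Longrightarrow> fold push_letter w v = rev w @ v"
proof (induction w arbitrary: v)
  case (Cons l w)
  have "push_letter l v = l # v"
    using Cons.prems
    by (cases v) (auto simp: push_letter_def reduced_word_append_iff reduced_word_Cons_iff)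
  then show ?case using Cons.IH[of "l # v"] Cons.prems by simp
qed simp

context free_product_2_3
begin

lemma S_neq_one: "S \<noteq> \<one>" and U_neq_one: "U \<noteq> \<one>"
  using nf_faithful[of 0 "[]" True] nf_faithful[of 1 "[]" False] by (auto simp: nf_word_def)

text \<open>If \<open>S\<close> fixes the coset \<open>H #> g\<close>, then \<open>g S g^-1\<close>
  is a nontrivial element of finite order in \<open>H\<close>, while free groups are torsion-free.
  The same holds for \<open>U\<close>.\<close>

lemma free_imp_fixed_point_free:
  assumes H: "subgroup H G" and free: "free_group (G\<lparr>carrier := H\<rparr>)" and C: "C \<in> rcosets H"
  shows "C #> S \<noteq> C" "C #> U \<noteq> C"
proof -
  have HG: "H \<subseteq> carrier G" using H by (rule subgroup.subset)
  obtain g where g: "g \<in> carrier G" "C = H #> g" using C by (auto simp: RCOSETS_def)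
  interpret K: group "G\<lparr>carrier := H\<rparr>" using H by (rule subgroup_imp_group)
  obtain X where X: "free_basis (G\<lparr>carrier := H\<rparr>) X" using free by (auto simp: free_group_def)
  have *: "x = \<one>" if x: "x \<in> carrier G" "x [^] n = \<one>" "n > 0" "C #> x = C" for x and n :: nat
  proof -
    have "H #> (g \<otimes> x) = H #> g" using x g HG by (simp add: coset_mult_assoc)
    then have h: "g \<otimes> x \<otimes> inv g \<in> H" using rcoset_eq_iff[OF H] g x by simp
    have "(g \<otimes> x \<otimes> inv g) [^] k = g \<otimes> x [^] k \<otimes> inv g" for k :: nat
    proof (induction k)
      case (Suc k)
      have "inv g \<otimes> (g \<otimes> (x \<otimes> inv g)) = x \<otimes> inv g"
        using g x by (simp flip: m_assoc)
      then show ?case using Suc g x by (simp add: m_assoc)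
    qed (use g in simp)
    then have "(g \<otimes> x \<otimes> inv g) [^] n = \<one>" using x g by simp
    then have "(g \<otimes> x \<otimes> inv g) [^]\<^bsub>G\<lparr>carrier := H\<rparr>\<^esub> n = \<one>\<^bsub>G\<lparr>carrier := H\<rparr>\<^esub>"
      by (simp flip: nat_pow_consistent)
    then have "g \<otimes> x \<otimes> inv g = \<one>"
      using K.free_basis_torsion_free[OF X _ x(3)] h by simp
    then have "g \<otimes> x = g" using g x by (metis inv_equality inv_inv inv_closed m_closed)
    then show ?thesis using g x by (metis l_cancel_one')
  qed
  have "S [^] (2::nat) = \<one>" "U [^] (3::nat) = \<one>"
    using S_square U_cube by (simp_all add: numeral_2_eq_2 numeral_3_eq_3 m_assoc)
  then show "C #> S \<noteq> C" "C #> U \<noteq> C" using *[of S 2] *[of U 3] S_neq_one U_neq_one by auto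
qed

text \<open>A spanning tree grown by whole \<open>U\<close>-triangles joined through
  \<open>S\<close>-edges. Thus \<open>t\<close> is compatible with every \<open>U\<close>-edge,
  which is consistent around a triangle because \<open>U\<close> has order 3. The last conclusion is
  induction along the tree.\<close>

lemma schreier_transversal:
  assumes H: "subgroup H G" and fin: "finite (rcosets H)"
    and fpf: "\<And>C. C \<in> rcosets H \<Longrightarrow> C #> U \<noteq> C"
  obtains t where "t H = \<one>"
    and "\<And>C. C \<in> rcosets H \<Longrightarrow> t C \<in> carrier G"
    and "\<And>C. C \<in> rcosets H \<Longrightarrow> H #> t C = C"
    and "\<And>C. C \<in> rcosets H \<Longrightarrow> t (C #> U) = t C \<otimes> U"
    and "\<And>P C. P H \<Longrightarrow> (\<And>C. C \<in> rcosets H \<Longrightarrow> P C \<Longrightarrow> P (C #> U)) \<Longrightarrow>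
       (\<And>C. C \<in> rcosets H \<Longrightarrow> t (C #> S) = t C \<otimes> S \<Longrightarrow> P C \<Longrightarrow> P (C #> S)) \<Longrightarrow>
       C \<in> rcosets H \<Longrightarrow> P C"
proof -
  let ?R = "rcosets H"
  have HG: "H \<subseteq> carrier G" using H by (rule subgroup.subset)
  have R: "C #> S \<in> ?R" "C #> U \<in> ?R" "C #> S #> S = C" "C #> U #> U #> U = C" if "C \<in> ?R" for C
    using act23_rcosets[OF HG] that by (auto simp: act23_def)
  \<comment> \<open>\<open>Q B t\<close> describes a partial tree: \<open>B\<close> is a union of
    triangles with representatives \<open>t\<close>. By the last clause a property of
    \<open>H\<close> spreads over \<open>B\<close> along the \<open>U\<close>-edges and those
    \<open>S\<close>-edges that \<open>t\<close> follows.\<close>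
  define Q where "Q = (\<lambda>B t. B \<subseteq> ?R \<and> (\<forall>C\<in>B. C #> U \<in> B) \<and>
    (\<forall>C\<in>B. t C \<in> carrier G \<and> H #> t C = C \<and> t (C #> U) = t C \<otimes> U) \<and>
    (\<forall>P. P H \<longrightarrow> (\<forall>C\<in>B. P C \<longrightarrow> P (C #> U)) \<longrightarrow>
       (\<forall>C\<in>B. C #> S \<in> B \<longrightarrow> t (C #> S) = t C \<otimes> S \<longrightarrow> P C \<longrightarrow> P (C #> S)) \<longrightarrow> (\<forall>C\<in>B. P C)))"
  have extend: "\<exists>B' t'. Q B' t' \<and> B \<subset> B' \<and> D \<in> B' \<and> t' D = g \<and> (\<forall>C\<in>B. t' C = t C)"
    if Q: "Q B t" and D: "D \<in> ?R" "D \<notin> B" "g \<in> carrier G" "H #> g = D"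
      and cause: "D = H \<or> (\<exists>C\<in>B. D = C #> S \<and> g = t C \<otimes> S)" for B t D g
  proof -
    let ?D1 = "D #> U" and ?D2 = "D #> U #> U"
    define B' where "B' = B \<union> {D, ?D1, ?D2}"
    define t' where "t' = t(D := g, ?D1 := g \<otimes> U, ?D2 := g \<otimes> U \<otimes> U)"
    have BU: "C #> U \<in> B" if "C \<in> B" for C using Q that by (simp add: Q_def)
    have new: "?D1 \<notin> B" "?D2 \<notin> B" using BU R(4)[OF D(1)] D(2) by metis+
    \<comment> \<open>Without fixed points of \<open>U\<close> the triangle has three distinct
      vertices, so the three updates of \<open>t\<close> do not collide.\<close>
    have dist: "D \<noteq> ?D1" "?D1 \<noteq> ?D2" "D \<noteq> ?D2"
      using fpf[OF D(1)] fpf[OF R(2)[OF D(1)]] R(4)[OF D(1)] by metis+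
    have t'B: "t' C = t C" if "C \<in> B" for C using that new D(2) by (auto simp: t'_def)
    have t'D: "t' D = g" "t' ?D1 = g \<otimes> U" "t' ?D2 = g \<otimes> U \<otimes> U" using dist by (auto simp: t'_def)
    have "Q B' t'"
      unfolding Q_def
    proof (intro conjI)
      show "B' \<subseteq> ?R" using Q D R by (auto simp: Q_def B'_def)
      show "\<forall>C\<in>B'. C #> U \<in> B'" using BU R(4)[OF D(1)] by (auto simp: B'_def)
      have "g \<otimes> U \<otimes> U \<otimes> U = g" using D U_cube by (simp add: m_assoc)
      moreover have "H #> (g \<otimes> U) = ?D1" "H #> (g \<otimes> U \<otimes> U) = ?D2"
        using D HG by (simp_all add: coset_mult_assoc[symmetric])
      moreover have "\<forall>C\<in>B. t' C \<in> carrier G \<and> H #> t' C = C \<and> t' (C #> U) = t' C \<otimes> U"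
        using Q BU t'B by (simp add: Q_def)
      ultimately show "\<forall>C\<in>B'. t' C \<in> carrier G \<and> H #> t' C = C \<and> t' (C #> U) = t' C \<otimes> U"
        using D t'D R(4)[OF D(1)] unfolding B'_def by auto
      show "\<forall>P. P H \<longrightarrow> (\<forall>C\<in>B'. P C \<longrightarrow> P (C #> U)) \<longrightarrow>
        (\<forall>C\<in>B'. C #> S \<in> B' \<longrightarrow> t' (C #> S) = t' C \<otimes> S \<longrightarrow> P C \<longrightarrow> P (C #> S)) \<longrightarrow> (\<forall>C\<in>B'. P C)"
      proof (intro allI impI)
        fix P assume P: "P H" "\<forall>C\<in>B'. P C \<longrightarrow> P (C #> U)"
          "\<forall>C\<in>B'. C #> S \<in> B' \<longrightarrow> t' (C #> S) = t' C \<otimes> S \<longrightarrow> P C \<longrightarrow> P (C #> S)"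
        have "\<forall>C\<in>B. P C \<longrightarrow> P (C #> U)"
          "\<forall>C\<in>B. C #> S \<in> B \<longrightarrow> t (C #> S) = t C \<otimes> S \<longrightarrow> P C \<longrightarrow> P (C #> S)"
          using P t'B by (auto simp: B'_def)
        then have PB: "\<forall>C\<in>B. P C" using Q P(1) unfolding Q_def by blast
        have "P D" using cause
        proof
          assume "\<exists>C\<in>B. D = C #> S \<and> g = t C \<otimes> S"
          then obtain C where "C \<in> B" "D = C #> S" "g = t C \<otimes> S" by blast
          then show "P D" using P(3) PB t'B t'D(1) by (auto simp: B'_def)
        qed (use P in simp)
        then have "P ?D1" using P(2) by (simp add: B'_def)
        then have "P ?D2" using P(2) by (simp add: B'_def)
        with PB \<open>P D\<close> \<open>P ?D1\<close> show "\<forall>C\<in>B'. P C" by (auto simp: B'_def)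
      qed
    qed
    then show ?thesis using t'B t'D(1) D(2) by (intro exI[of _ B'] exI[of _ t']) (auto simp: B'_def)
  qed
  define good where "good = (\<lambda>B. \<exists>t. Q B t \<and> H \<in> B \<and> t H = \<one>)"
  have HR: "H \<in> ?R" using H by (simp add: subgroup.subgroup_in_rcosets is_group)
  have "Q {} (\<lambda>_. \<one>)" by (simp add: Q_def)
  from extend[OF this HR _ one_closed] obtain B0 t0 where "Q B0 t0" "H \<in> B0" "t0 H = \<one>"
    using HG by auto
  then have B0: "good B0" by (auto simp: good_def)
  have "Collect good \<subseteq> Pow ?R" by (auto simp: good_def Q_def)
  then have fin_good: "finite (Collect good)"
    using fin by (auto intro: finite_subset)
  then obtain B where B: "good B" "\<And>B'. good B' \<Longrightarrow> B \<subseteq> B' \<Longrightarrow> B = B'"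
    using finite_has_maximal[OF fin_good] B0 by auto
  then obtain t where t: "Q B t" "H \<in> B" "t H = \<one>" by (auto simp: good_def)
  have BR: "B \<subseteq> ?R" using t(1) by (simp add: Q_def)
  \<comment> \<open>If an \<open>S\<close>-edge left \<open>B\<close>, the triangle at its far end
    could be added, contradicting maximality.\<close>
  have BS: "C #> S \<in> B" if C: "C \<in> B" for C
  proof (rule ccontr)
    assume nin: "C #> S \<notin> B"
    have tC: "t C \<in> carrier G" "H #> t C = C" using t(1) C by (auto simp: Q_def)
    then have tS: "t C \<otimes> S \<in> carrier G" "H #> (t C \<otimes> S) = C #> S"
      using HG by (simp_all add: coset_mult_assoc[symmetric])
    have CR: "C \<in> ?R" using C BR by blast
    have "C #> S = H \<or> (\<exists>C'\<in>B. C #> S = C' #> S \<and> t C \<otimes> S = t C' \<otimes> S)" using C by blast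
    from extend[OF t(1) R(1)[OF CR] nin tS this]
    obtain B' t' where B': "Q B' t'" "B \<subset> B'" "\<forall>C\<in>B. t' C = t C" by auto
    then have "good B'" using t by (auto simp: good_def)
    then show False using B(2)[of B'] B' by auto
  qed
  have "word_act (\<lambda>C. C #> S) (\<lambda>C. C #> U) w C \<in> B" if "C \<in> B" for w C
    using that BS t(1) by (induction w arbitrary: C) (auto simp: Q_def)
  then have "H #> ev w \<in> B" for w
    using word_act_rcoset[OF HG, of \<one> w] t(2) HG by (metis coset_mult_one ev_closed l_one one_closed)
  then have B_eq: "B = ?R" using BR by (auto simp: rcosets_eq)
  show thesis
  proof (rule that[of t])
    show "t H = \<one>" by (rule t(3))
    show "t C \<in> carrier G" "H #> t C = C" "t (C #> U) = t C \<otimes> U" if "C \<in> ?R" for C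
      using t(1) that unfolding Q_def B_eq by simp_all
    fix P C assume P: "P H" "\<And>C. C \<in> ?R \<Longrightarrow> P C \<Longrightarrow> P (C #> U)"
      "\<And>C. C \<in> ?R \<Longrightarrow> t (C #> S) = t C \<otimes> S \<Longrightarrow> P C \<Longrightarrow> P (C #> S)" and C: "C \<in> ?R"
    have "P H \<longrightarrow> (\<forall>C\<in>?R. P C \<longrightarrow> P (C #> U)) \<longrightarrow>
       (\<forall>C\<in>?R. C #> S \<in> ?R \<longrightarrow> t (C #> S) = t C \<otimes> S \<longrightarrow> P C \<longrightarrow> P (C #> S)) \<longrightarrow> (\<forall>C\<in>?R. P C)"
      using t(1) unfolding Q_def B_eq by (elim conjE) (erule spec)
    then show "P C" using P C by simp
  qed
qed

text \<open>The free group on \<open>E\<close>, realized on reduced words, is made to act together with the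
  coset action: \<open>S\<close> multiplies by the letter of the edge it crosses.  Non-tree edges of the coset
  graph thereby yield the letters of a basis.\<close>

lemma fixed_point_free_imp_free:
  assumes H: "subgroup H G" and fin: "finite (rcosets H)"
    and fpf: "\<And>C. C \<in> rcosets H \<Longrightarrow> C #> S \<noteq> C" "\<And>C. C \<in> rcosets H \<Longrightarrow> C #> U \<noteq> C"
  shows "free_group (G\<lparr>carrier := H\<rparr>)"
proof -
  let ?R = "rcosets H" and ?K = "G\<lparr>carrier := H\<rparr>"
  have HG: "H \<subseteq> carrier G" using H by (rule subgroup.subset)
  have R: "C #> S \<in> ?R" "C #> U \<in> ?R" "C #> S #> S = C" "C #> U #> U #> U = C" if "C \<in> ?R" for C
    using act23_rcosets[OF HG] that by (auto simp: act23_def)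
  have HR: "H \<in> ?R" using H by (simp add: subgroup.subgroup_in_rcosets is_group)
  obtain t where tH: "t H = \<one>"
    and t: "\<And>C. C \<in> ?R \<Longrightarrow> t C \<in> carrier G" "\<And>C. C \<in> ?R \<Longrightarrow> H #> t C = C"
      "\<And>C. C \<in> ?R \<Longrightarrow> t (C #> U) = t C \<otimes> U"
    and tree: "\<And>P C. P H \<Longrightarrow> (\<And>C. C \<in> ?R \<Longrightarrow> P C \<Longrightarrow> P (C #> U)) \<Longrightarrow>
       (\<And>C. C \<in> ?R \<Longrightarrow> t (C #> S) = t C \<otimes> S \<Longrightarrow> P C \<Longrightarrow> P (C #> S)) \<Longrightarrow> C \<in> ?R \<Longrightarrow> P C"
  proof (rule schreier_transversal[OF H fin fpf(2)])
    fix t assume t: "t H = \<one>" "\<And>C. C \<in> ?R \<Longrightarrow> t C \<in> carrier G" "\<And>C. C \<in> ?R \<Longrightarrow> H #> t C = C"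
      "\<And>C. C \<in> ?R \<Longrightarrow> t (C #> U) = t C \<otimes> U"
      "\<And>P C. P H \<Longrightarrow> (\<And>C. C \<in> ?R \<Longrightarrow> P C \<Longrightarrow> P (C #> U)) \<Longrightarrow>
       (\<And>C. C \<in> ?R \<Longrightarrow> t (C #> S) = t C \<otimes> S \<Longrightarrow> P C \<Longrightarrow> P (C #> S)) \<Longrightarrow> C \<in> ?R \<Longrightarrow> P C"
    show thesis by (rule that[of t]) (fact t)+
  qed
  \<comment> \<open>The Schreier generator of the \<open>S\<close>-edge at \<open>C\<close>. The
    generators of \<open>U\<close>-edges are trivial by the choice of \<open>t\<close>, as are those
    of the \<open>S\<close>-edges in the tree.\<close>
  define gen where "gen = (\<lambda>C. t C \<otimes> S \<otimes> inv t (C #> S))"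
  have gen_carrier: "gen C \<in> carrier G" if "C \<in> ?R" for C using that t R by (simp add: gen_def)
  have gen_H: "gen C \<in> H" if "C \<in> ?R" for C
  proof -
    have "H #> (t C \<otimes> S) = H #> t (C #> S)"
      using that t R HG by (simp add: coset_mult_assoc[symmetric])
    moreover have "t C \<otimes> S \<in> carrier G" "t (C #> S) \<in> carrier G" using that t R by auto
    ultimately show ?thesis using rcoset_eq_iff[OF H] unfolding gen_def by blast
  qed
  have inv_S: "inv S = S" using S_square by (simp add: inv_equality)
  have gen_S: "gen (C #> S) = inv gen C" if "C \<in> ?R" for C
    using that t R by (simp add: gen_def inv_mult_group inv_S m_assoc)
  \<comment> \<open>The two ends of an \<open>S\<close>-edge give mutually inverse generators. An
    arbitrary numbering of the cosets selects one end for the basis.\<close>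
  obtain f :: "'a set \<Rightarrow> nat" where f: "inj_on f ?R"
    using finite_imp_inj_to_nat_seg[OF fin] by blast
  define E where "E = {C \<in> ?R. gen C \<noteq> \<one> \<and> f C < f (C #> S)}"
  define X where "X = gen ` E"
  have ER: "E \<subseteq> ?R" by (auto simp: E_def)
  have XH: "X \<subseteq> H" using gen_H by (auto simp: X_def E_def)
  have f_S: "f C \<noteq> f (C #> S)" if "C \<in> ?R" for C
    using f fpf(1) R(1) that by (metis inj_on_eq_iff)
  have gen_one_S: "gen (C #> S) = \<one> \<longleftrightarrow> gen C = \<one>" if "C \<in> ?R" for C
    using gen_S[OF that] gen_carrier[OF that] by simp
  have E_S: "C #> S \<in> E \<longleftrightarrow> C \<notin> E" if "C \<in> ?R" "gen C \<noteq> \<one>" for C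
    using that R f_S[OF that(1)] gen_one_S[OF that(1)] by (auto simp: E_def)

  have generates: "generate G X = H"
  proof
    show "generate G X \<subseteq> H" using generate_subgroup_incl[OF XH H] .
    have XG: "X \<subseteq> carrier G" using XH HG by auto
    have gen_in: "gen C \<in> generate G X" if C: "C \<in> ?R" for C
    proof -
      consider "gen C = \<one>" | "C \<in> E" | "gen C \<noteq> \<one>" "C #> S \<in> E" using E_S[OF C] by blast
      then show ?thesis
      proof cases
        case 3
        then have "inv gen (C #> S) \<in> generate G X" by (auto simp: X_def intro: generate.inv)
        then show ?thesis using gen_S[OF C] gen_carrier[OF C] by simp
      qed (auto simp: X_def intro: generate.one generate.incl)
    qed
    \<comment> \<open>Schreier rewriting, letter by letter. For \<open>ev w\<close> in
      \<open>H\<close> the coset is \<open>H\<close> itself, and the correcting factor is trivial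
      because \<open>t H = \<one>\<close>.\<close>
    have *: "ev w \<otimes> inv t (H #> ev w) \<in> generate G X" for w
    proof (induction w rule: rev_induct)
      case Nil
      then show ?case using HG tH by (auto intro: generate.one)
    next
      case (snoc l w)
      let ?C = "H #> ev w"
      have C: "?C \<in> ?R" using HG by (simp add: rcosetsI)
      have c: "H #> (ev w \<otimes> g) = ?C #> g" if "g \<in> carrier G" for g
        using HG that by (simp add: coset_mult_assoc)
      have step: "ev w \<otimes> g \<otimes> inv t (?C #> g) =
          ev w \<otimes> inv t ?C \<otimes> (t ?C \<otimes> g \<otimes> inv t (?C #> g))" if "g \<in> carrier G" "?C #> g \<in> ?R" for g
      proof -
        have "inv t ?C \<otimes> (t ?C \<otimes> (g \<otimes> inv t (?C #> g))) = g \<otimes> inv t (?C #> g)"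
          using t(1)[OF C] t(1)[OF that(2)] that(1) by (simp flip: m_assoc)
        then show ?thesis using t(1)[OF C] t(1)[OF that(2)] that(1) by (simp add: m_assoc)
      qed
      show ?case
      proof (cases l)
        case True
        then show ?thesis using snoc gen_in[OF C] step[of S] R(1)[OF C]
          by (auto simp: c gen_def intro: generate.eng)
      next
        case False
        have "t ?C \<otimes> U \<otimes> inv t (?C #> U) = \<one>" using t(1,3)[OF C] by simp
        then show ?thesis using snoc False step[of U] R(2)[OF C] t(1)[OF C] by (simp add: c)
      qed
    qed
    show "H \<subseteq> generate G X"
    proof
      fix h assume h: "h \<in> H"
      then obtain w where w: "ev w = h" using generated HG by blast
      have "H #> h = H" using h H HG by (simp add: coset_join2 subset_iff)
      then show "h \<in> generate G X" using *[of w] tH h HG w by auto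
    qed
  qed

  \<comment> \<open>Crossing an edge backwards must undo its label, so that \<open>sW\<close> is an
    involution on reduced words. Edges with trivial generator carry no label.\<close>
  define lab where "lab = (\<lambda>C. if gen C = \<one> then [] else if C \<in> E then [(True, C)] else [(False, C #> S)])"
  define sW where "sW = (\<lambda>(C, w). (C #> S, fold push_letter (lab C) w))"
  have sW_apply: "sW (C, w) = (C #> S, fold push_letter (lab C) w)" for C w by (simp add: sW_def)
  define uW where "uW = (\<lambda>(C, w :: (bool \<times> 'a set) list). (C #> U, w))"
  let ?W = "?R \<times> Collect reduced_word"
  have lab_S: "fold push_letter (lab (C #> S)) (fold push_letter (lab C) w) = w"
    if "C \<in> ?R" "reduced_word w" for C w
    using that E_S[OF that(1)] gen_one_S[OF that(1)] R(3)[OF that(1)]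
      push_letter_cancel[OF that(2), of True, simplified]
    by (auto simp: lab_def)
  have lab_reduced: "reduced_word (fold push_letter (lab C) w)" if "reduced_word w" for C w
    using that by (auto simp: lab_def reduced_word_push_letter)
  have act: "act23 ?W sW uW"
    using R lab_S lab_reduced by (auto simp: act23_def sW_def uW_def)
  have HW: "(H, w) \<in> ?W" if "reduced_word w" for w using HR that by simp
  \<comment> \<open>Walking from \<open>H\<close> to \<open>C\<close> inside the tree crosses no
    labelled edge, so the word component is unchanged.\<close>
  have along_tree: "\<exists>v. ev v = t C \<and> (\<forall>w. reduced_word w \<longrightarrow> word_act sW uW v (H, w) = (C, w))"
    if "C \<in> ?R" for C
  proof (rule tree[OF _ _ _ that])
    show "\<exists>v. ev v = t H \<and> (\<forall>w. reduced_word w \<longrightarrow> word_act sW uW v (H, w) = (H, w))"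
      by (intro exI[of _ "[]"]) (simp add: tH)
  next
    fix C assume C: "C \<in> ?R"
      "\<exists>v. ev v = t C \<and> (\<forall>w. reduced_word w \<longrightarrow> word_act sW uW v (H, w) = (C, w))"
    then obtain v where v: "ev v = t C"
      "\<forall>w. reduced_word w \<longrightarrow> word_act sW uW v (H, w) = (C, w)" by blast
    show "\<exists>v. ev v = t (C #> U) \<and>
        (\<forall>w. reduced_word w \<longrightarrow> word_act sW uW v (H, w) = (C #> U, w))"
      using v t(3)[OF C(1)] by (intro exI[of _ "v @ [False]"]) (simp add: uW_def)
    assume tS: "t (C #> S) = t C \<otimes> S"
    then have "gen C = \<one>" using t(1)[OF C(1)] by (simp add: gen_def)
    then show "\<exists>v. ev v = t (C #> S) \<and>
        (\<forall>w. reduced_word w \<longrightarrow> word_act sW uW v (H, w) = (C #> S, w))"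
      using v tS by (intro exI[of _ "v @ [True]"]) (simp add: sW_def lab_def)
  qed
  have loop: "\<exists>v. ev v = gen C \<and>
      (\<forall>w. reduced_word w \<longrightarrow> word_act sW uW v (H, w) = (H, fold push_letter (lab C) w))"
    if C: "C \<in> ?R" for C
  proof -
    obtain v where v: "ev v = t C"
      "\<And>w. reduced_word w \<Longrightarrow> word_act sW uW v (H, w) = (C, w)" using along_tree[OF C] by blast
    obtain v' where v': "ev v' = t (C #> S)"
      "\<And>w. reduced_word w \<Longrightarrow> word_act sW uW v' (H, w) = (C #> S, w)"
      using along_tree[OF R(1)[OF C]] by blast
    have return: "word_act sW uW (word_inv v') (C #> S, w) = (H, w)" if "reduced_word w" for w
      using act23_word_inv[OF act HW[OF that], of v'] v'(2)[OF that] by simp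
    show ?thesis
    proof (intro exI[of _ "v @ True # word_inv v'"] conjI allI impI)
      show "ev (v @ True # word_inv v') = gen C"
        using v v' t(1)[OF C] t(1)[OF R(1)[OF C]] by (simp add: gen_def m_assoc)
      fix w :: "(bool \<times> 'a set) list" assume "reduced_word w"
      then show "word_act sW uW (v @ True # word_inv v') (H, w) = (H, fold push_letter (lab C) w)"
        by (simp add: v(2) sW_apply return lab_reduced)
    qed
  qed
  \<comment> \<open>The letters that act are cosets in \<open>E\<close>, those of the basis are
    group elements; \<open>c\<close> translates, picking one coset for each element of
    \<open>X\<close>.\<close>
  define c where "c = inv_into E gen"
  have c: "c x \<in> E" "gen (c x) = x" if "x \<in> X" for x
    using that by (auto simp: c_def X_def inv_into_into f_inv_into_f)
  have letter: "\<exists>v. ev v = (if b then x else inv x) \<and>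
      (\<forall>w. reduced_word w \<longrightarrow> word_act sW uW v (H, w) = (H, push_letter (b, c x) w))"
    if x: "x \<in> X" for b x
  proof -
    have cR: "c x \<in> ?R" "gen (c x) \<noteq> \<one>" using c[OF x] by (auto simp: E_def)
    show ?thesis
    proof (cases b)
      case True
      have "lab (c x) = [(b, c x)]" using c[OF x] cR True by (simp add: lab_def)
      then show ?thesis using loop[OF cR(1)] c[OF x] True by simp
    next
      case False
      have "lab (c x #> S) = [(b, c x)]"
        using c[OF x] cR gen_one_S[OF cR(1)] E_S[OF cR] R(3)[OF cR(1)] False by (simp add: lab_def)
      moreover have "gen (c x #> S) = inv x" using gen_S[OF cR(1)] c[OF x] by simp
      ultimately show ?thesis using loop[OF R(1)[OF cR(1)]] False by simp
    qed
  qed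
  have words: "\<exists>v. ev v = word_value ?K ws \<and> (\<forall>w. reduced_word w \<longrightarrow>
      word_act sW uW v (H, w) = (H, fold push_letter (map (\<lambda>(b, x). (b, c x)) ws) w))"
    if "ws \<in> lists (UNIV \<times> X)" for ws
    using that
  proof (induction ws)
    case Nil
    show ?case by (intro exI[of _ "[]"]) simp
  next
    case (Cons l ws)
    obtain b x where l: "l = (b, x)" "x \<in> X" using Cons by auto
    obtain v where v: "ev v = word_value ?K ws" "\<And>w. reduced_word w \<Longrightarrow>
      word_act sW uW v (H, w) = (H, fold push_letter (map (\<lambda>(b, x). (b, c x)) ws) w)"
      using Cons by blast
    obtain v' where v': "ev v' = (if b then x else inv x)"
      "\<And>w. reduced_word w \<Longrightarrow> word_act sW uW v' (H, w) = (H, push_letter (b, c x) w)"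
      using letter[OF l(2)] by blast
    have "inv\<^bsub>?K\<^esub> x = inv x" using l XH H by (simp add: m_inv_consistent subset_iff)
    then show ?case using v v' l
      by (intro exI[of _ "v' @ v"]) (auto simp: reduced_word_push_letter)
  qed
  have "free_basis ?K X"
    unfolding free_basis_def
  proof (intro conjI ballI impI)
    show "X \<subseteq> carrier ?K" using XH by simp
    show "generate ?K X = carrier ?K" using generate_consistent[OF XH H] generates by simp
    fix ws assume ws: "ws \<in> lists (UNIV \<times> X)" "reduced_word ws" "ws \<noteq> []"
    define ls where "ls = map (\<lambda>(b, x). (b, c x)) ws"
    have "reduced_word ls" using ws(1,2)
    proof (unfold ls_def, induction ws)
      case (Cons l ws)
      then have "c (snd l) = c (snd (hd ws)) \<longrightarrow> snd l = snd (hd ws)" if "ws \<noteq> []"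
        using that by (cases ws) (auto, metis c(2))
      then show ?case using Cons by (auto simp: reduced_word_Cons_iff hd_map case_prod_beta)
    qed simp
    then have red: "fold push_letter ls [] = rev ls" using fold_push_letter_reduced[of "[]" ls] by simp
    obtain v where v: "ev v = word_value ?K ws"
      "word_act sW uW v (H, []) = (H, fold push_letter ls [])"
      using words[OF ws(1)] by (auto simp: ls_def)
    \<comment> \<open>Acting on \<open>(H, [])\<close>, the value of \<open>ws\<close> leaves the
      whole word behind in reverse, whereas the identity would leave the empty word.\<close>
    show "word_value ?K ws \<noteq> \<one>\<^bsub>?K\<^esub>"
    proof
      assume "word_value ?K ws = \<one>\<^bsub>?K\<^esub>"
      then have "ev v = ev []" using v by simp
      then have "word_act sW uW v (H, []) = (H, [])"
        using word_act_cong[OF act HW[of "[]"]] by (metis reduced_word_simps(1) word_act.simps(1))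
      then show False using v red ws(3) by (simp add: ls_def)
    qed
  qed
  then show ?thesis using H subgroup_imp_group by (auto simp: free_group_def)
qed

end

section \<open>Counting fixed-point-free permutation pairs\<close>

text \<open>Being the identity outside \<open>A\<close> makes each permutation of \<open>A\<close>
  correspond to exactly one function, so that cardinalities are meaningful.\<close>

definition fpf_involutions :: "'x set \<Rightarrow> ('x \<Rightarrow> 'x) set" where
  "fpf_involutions A = {s. (\<forall>x. x \<notin> A \<longrightarrow> s x = x) \<and> (\<forall>x\<in>A. s x \<in> A \<and> s x \<noteq> x \<and> s (s x) = x)}"

definition fpf_order_3 :: "'x set \<Rightarrow> ('x \<Rightarrow> 'x) set" where
  "fpf_order_3 A = {u. (\<forall>x. x \<notin> A \<longrightarrow> u x = x) \<and> (\<forall>x\<in>A. u x \<in> A \<and> u x \<noteq> x \<and> u (u (u x)) = x)}"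

fun num_fpf_involutions :: "nat \<Rightarrow> nat" where
  "num_fpf_involutions 0 = 1"
| "num_fpf_involutions (Suc 0) = 0"
| "num_fpf_involutions (Suc (Suc n)) = (n + 1) * num_fpf_involutions n"

fun num_fpf_order_3 :: "nat \<Rightarrow> nat" where
  "num_fpf_order_3 0 = 1"
| "num_fpf_order_3 (Suc 0) = 0"
| "num_fpf_order_3 (Suc (Suc 0)) = 0"
| "num_fpf_order_3 (Suc (Suc (Suc n))) = (n + 2) * (n + 1) * num_fpf_order_3 n"

text \<open>The cycle of a chosen point \<open>a\<close> is split off: \<open>n + 1\<close>
  candidates for its partner, and an involution of the remaining \<open>n\<close> points.\<close>

lemma fpf_involutions_card:
  "finite A \<Longrightarrow> finite (fpf_involutions A) \<and> card (fpf_involutions A) = num_fpf_involutions (card A)"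
proof (induction "card A" arbitrary: A rule: num_fpf_involutions.induct)
  case 1
  then have "fpf_involutions A = {id}" by (auto simp: fpf_involutions_def id_def)
  then show ?case using 1 by simp
next
  case 2
  then obtain a where "A = {a}" by (metis One_nat_def card_1_singletonE)
  then have "fpf_involutions A = {}" by (auto simp: fpf_involutions_def)
  then show ?case using 2 by (metis card.empty finite.emptyI num_fpf_involutions.simps(2))
next
  case (3 n)
  then obtain a where a: "a \<in> A" by fastforce
  let ?T = "SIGMA b:A - {a}. fpf_involutions (A - {a, b})"
  let ?f = "\<lambda>s. (s a, s(a := a, s a := s a))"
  let ?g = "\<lambda>(b, s). s(a := b, b := a)"
  have bij: "bij_betw ?f (fpf_involutions A) ?T"
  proof (rule bij_betw_byWitness[of _ ?g])
    show "\<forall>s\<in>fpf_involutions A. ?g (?f s) = s"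
      using a by (auto simp: fpf_involutions_def fun_eq_iff)
    show "\<forall>p\<in>?T. ?f (?g p) = p"
      using a by (auto simp: fpf_involutions_def fun_eq_iff)
    show "?f ` fpf_involutions A \<subseteq> ?T"
    proof (rule image_subsetI)
      fix s assume s: "s \<in> fpf_involutions A"
      then have s2: "s x \<in> A" "s x \<noteq> x" "s (s x) = x" if "x \<in> A" for x
        using that by (auto simp: fpf_involutions_def)
      have "s x \<notin> {a, s a}" if "x \<in> A" "x \<notin> {a, s a}" for x
        using s2[OF that(1)] s2[OF a] that(2) by (metis insert_iff empty_iff)
      then show "?f s \<in> ?T"
        using s s2 s2[OF a] by (auto simp: fpf_involutions_def)
    qed
    show "?g ` ?T \<subseteq> fpf_involutions A"
    proof (rule image_subsetI)
      fix p assume "p \<in> ?T"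
      then obtain b s where p: "p = (b, s)"
        and b: "b \<in> A" "b \<noteq> a" and s: "s \<in> fpf_involutions (A - {a, b})" by auto
      have s1: "s x \<in> A" "s x \<noteq> a" "s x \<noteq> b" "s x \<noteq> x" "s (s x) = x"
        if "x \<in> A" "x \<noteq> a" "x \<noteq> b" for x
        using s that by (auto simp: fpf_involutions_def)
      have s2: "s x = x" if "x \<notin> A" for x using s that by (simp add: fpf_involutions_def)
      have "s(a := b, b := a) \<in> fpf_involutions A"
        unfolding fpf_involutions_def mem_Collect_eq
      proof (intro conjI allI impI ballI)
        fix x assume "x \<in> A"
        then show "(s(a := b, b := a)) x \<in> A" "(s(a := b, b := a)) x \<noteq> x"
          "(s(a := b, b := a)) ((s(a := b, b := a)) x) = x"
          using a b s1[of x] by (cases "x = a"; cases "x = b"; simp)+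
      qed (use a b s2 in auto)
      then show "?g p \<in> fpf_involutions A" by (simp add: p)
    qed
  qed
  have IH: "finite (fpf_involutions (A - {a, b})) \<and>
      card (fpf_involutions (A - {a, b})) = num_fpf_involutions n" if "b \<in> A - {a}" for b
  proof -
    have "card (A - {a, b}) = card A - card {a, b}" using a that by (intro card_Diff_subset) auto
    moreover have "card {a, b} = 2" using that by auto
    ultimately have "card (A - {a, b}) = n" using 3(2) by simp
    then show ?thesis using 3(1)[of "A - {a, b}"] 3(3) by simp
  qed
  then have T: "finite ?T" "card ?T = (n + 1) * num_fpf_involutions n"
    using 3(2)[symmetric] 3(3) a by (auto simp: card_SigmaI)
  have "finite (fpf_involutions A)" using bij_betw_finite[OF bij] T(1) by blast
  moreover have "card (fpf_involutions A) = (n + 1) * num_fpf_involutions n"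
    using bij_betw_same_card[OF bij] T(2) by (rule trans)
  ultimately show ?case using 3(2)[symmetric] by simp
qed

text \<open>As for involutions, with an ordered choice of \<open>u a\<close> and
  \<open>u (u a)\<close>, which accounts for the factor \<open>(n + 2) * (n + 1)\<close>.\<close>

lemma fpf_order_3_card:
  "finite A \<Longrightarrow> finite (fpf_order_3 A) \<and> card (fpf_order_3 A) = num_fpf_order_3 (card A)"
proof (induction "card A" arbitrary: A rule: num_fpf_order_3.induct)
  case 1
  then have "fpf_order_3 A = {id}" by (auto simp: fpf_order_3_def id_def)
  then show ?case using 1 by simp
next
  case 2
  then obtain a where "A = {a}" by (metis One_nat_def card_1_singletonE)
  then have "fpf_order_3 A = {}" by (auto simp: fpf_order_3_def)
  then show ?case using 2 by (metis card.empty finite.emptyI num_fpf_order_3.simps(2))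
next
  case 3
  then obtain a b where "A = {a, b}" "a \<noteq> b" by (metis card_2_iff numeral_2_eq_2)
  then have "fpf_order_3 A = {}" by (auto simp: fpf_order_3_def)
  then show ?case using 3 by (metis card.empty finite.emptyI num_fpf_order_3.simps(3))
next
  case (4 n)
  then obtain a where a: "a \<in> A" by fastforce
  let ?B = "SIGMA b:A - {a}. A - {a, b}"
  let ?T = "SIGMA bc:?B. fpf_order_3 (A - {a, fst bc, snd bc})"
  let ?f = "\<lambda>u. ((u a, u (u a)), u(a := a, u a := u a, u (u a) := u (u a)))"
  let ?g = "\<lambda>((b, c), u). u(a := b, b := c, c := a)"
  have bij: "bij_betw ?f (fpf_order_3 A) ?T"
  proof (rule bij_betw_byWitness[of _ ?g])
    show "\<forall>u\<in>fpf_order_3 A. ?g (?f u) = u"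
      using a by (auto simp: fpf_order_3_def fun_eq_iff)
    show "\<forall>p\<in>?T. ?f (?g p) = p"
      using a by (auto simp: fpf_order_3_def fun_eq_iff)
    show "?f ` fpf_order_3 A \<subseteq> ?T"
    proof (rule image_subsetI)
      fix u assume u: "u \<in> fpf_order_3 A"
      then have u3: "u (u (u x)) = x" "u x \<in> A" "u x \<noteq> x" if "x \<in> A" for x
        using that by (auto simp: fpf_order_3_def)
      then have ua: "u a \<in> A" "u (u a) \<in> A" "u a \<noteq> a" "u (u a) \<noteq> u a" "u (u a) \<noteq> a" "u (u (u a)) = a"
        using a by metis+
      have "u x \<notin> {a, u a, u (u a)}" if "x \<in> A" "x \<notin> {a, u a, u (u a)}" for x
        using u3[OF that(1)] u3[OF u3(2)[OF that(1)]] ua that(2) by (metis insert_iff empty_iff)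
      then show "?f u \<in> ?T"
        using u ua u3 by (auto simp: fpf_order_3_def)
    qed
    show "?g ` ?T \<subseteq> fpf_order_3 A"
    proof (rule image_subsetI)
      fix p assume "p \<in> ?T"
      then obtain b c u where p: "p = ((b, c), u)"
        and bc: "b \<in> A" "b \<noteq> a" "c \<in> A" "c \<noteq> a" "c \<noteq> b" and u: "u \<in> fpf_order_3 (A - {a, b, c})" by force
      have u1: "u x \<in> A" "u x \<noteq> a" "u x \<noteq> b" "u x \<noteq> c" "u x \<noteq> x" "u (u (u x)) = x"
        if "x \<in> A" "x \<noteq> a" "x \<noteq> b" "x \<noteq> c" for x
        using u that by (auto simp: fpf_order_3_def)
      have u2: "u x = x" if "x \<notin> A" for x using u that by (simp add: fpf_order_3_def)
      let ?u = "u(a := b, b := c, c := a)"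
      have "?u \<in> fpf_order_3 A"
        unfolding fpf_order_3_def mem_Collect_eq
      proof (intro conjI allI impI ballI)
        fix x assume x: "x \<in> A"
        show "?u x \<in> A" "?u x \<noteq> x" "?u (?u (?u x)) = x"
        proof (atomize (full), cases "x \<in> {a, b, c}")
          case True
          then show "?u x \<in> A \<and> ?u x \<noteq> x \<and> ?u (?u (?u x)) = x" using a bc by auto
        next
          case False
          then have ne: "x \<noteq> a" "x \<noteq> b" "x \<noteq> c" by auto
          note v = u1[OF x ne] and w = u1[OF u1(1-4)[OF x ne]]
          show "?u x \<in> A \<and> ?u x \<noteq> x \<and> ?u (?u (?u x)) = x" using v w ne by simp
        qed
      qed (use a bc u2 in auto)
      then show "?g p \<in> fpf_order_3 A" by (simp add: p)
    qed
  qed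
  have IH: "finite (fpf_order_3 (A - {a, b, c})) \<and>
      card (fpf_order_3 (A - {a, b, c})) = num_fpf_order_3 n" if "b \<in> A - {a}" "c \<in> A - {a, b}" for b c
  proof -
    have "card (A - {a, b, c}) = card A - card {a, b, c}"
      using a that by (intro card_Diff_subset) auto
    moreover have "card {a, b, c} = 3" using that by auto
    ultimately have "card (A - {a, b, c}) = n" using 4(2) by simp
    then show ?thesis using 4(1)[of "A - {a, b, c}"] 4(3) by simp
  qed
  have "card (A - {a, b}) = n + 1" if "b \<in> A - {a}" for b
  proof -
    have "card (A - {a, b}) = card A - card {a, b}" using a that by (intro card_Diff_subset) auto
    moreover have "card {a, b} = 2" using that by auto
    ultimately show ?thesis using 4(2) by simp
  qed
  then have B: "finite ?B" "card ?B = (n + 2) * (n + 1)"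
    using 4(2)[symmetric] 4(3) a by (auto simp: card_SigmaI)
  have fib: "finite (fpf_order_3 (A - {a, fst bc, snd bc}))"
    "card (fpf_order_3 (A - {a, fst bc, snd bc})) = num_fpf_order_3 n" if "bc \<in> ?B" for bc
  proof -
    have "fst bc \<in> A - {a}" "snd bc \<in> A - {a, fst bc}"
      using that unfolding Sigma_def by force+
    then show "finite (fpf_order_3 (A - {a, fst bc, snd bc}))"
      "card (fpf_order_3 (A - {a, fst bc, snd bc})) = num_fpf_order_3 n" by (simp_all only: IH)
  qed
  have "card ?T = (\<Sum>bc\<in>?B. card (fpf_order_3 (A - {a, fst bc, snd bc})))"
    using B(1) fib(1) by (intro card_SigmaI) auto
  also have "\<dots> = (\<Sum>bc\<in>?B. num_fpf_order_3 n)" by (intro sum.cong refl fib(2))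
  also have "\<dots> = (n + 2) * (n + 1) * num_fpf_order_3 n" unfolding sum_constant B(2) of_nat_id ..
  finally have T_card: "card ?T = (n + 2) * (n + 1) * num_fpf_order_3 n" .
  have T_fin: "finite ?T" by (rule finite_SigmaI[OF B(1) fib(1)])
  have "finite (fpf_order_3 A)" using bij_betw_finite[OF bij] T_fin by blast
  moreover have "card (fpf_order_3 A) = (n + 2) * (n + 1) * num_fpf_order_3 n"
    using bij_betw_same_card[OF bij] T_card by (rule trans)
  ultimately show ?case using 4(2)[symmetric] by simp
qed

lemma num_fpf_involutions_odd: "odd n \<Longrightarrow> num_fpf_involutions n = 0"
  by (induction n rule: num_fpf_involutions.induct) auto

lemma num_fpf_order_3_not_dvd: "\<not> 3 dvd n \<Longrightarrow> num_fpf_order_3 n = 0"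
proof (induction n rule: num_fpf_order_3.induct)
  case (4 n)
  then have "\<not> 3 dvd n" by presburger
  then show ?case using 4 by simp
qed auto

definition fpf_pairs :: "'x set \<Rightarrow> (('x \<Rightarrow> 'x) \<times> ('x \<Rightarrow> 'x)) set" where
  "fpf_pairs A = fpf_involutions A \<times> fpf_order_3 A"

definition num_fpf_pairs :: "nat \<Rightarrow> nat" where
  "num_fpf_pairs n = num_fpf_involutions n * num_fpf_order_3 n"

lemma fpf_pairs_card:
  assumes "finite A"
  shows "finite (fpf_pairs A)" "card (fpf_pairs A) = num_fpf_pairs (card A)"
  using fpf_involutions_card[OF assms] fpf_order_3_card[OF assms]
  by (auto simp: fpf_pairs_def num_fpf_pairs_def card_cartesian_product)

lemma num_fpf_pairs_not_dvd: "\<not> 6 dvd n \<Longrightarrow> num_fpf_pairs n = 0"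
  using num_fpf_involutions_odd[of n] num_fpf_order_3_not_dvd[of n]
  by (auto simp: num_fpf_pairs_def) presburger

text \<open>With \<open>x = 6 l\<close>, six more points multiply the involutions by
  \<open>(x+1)(x+3)(x+5)\<close>, the permutations of order 3 by
  \<open>(x+1)(x+2)(x+4)(x+5)\<close>, and the factorial by \<open>(x+1)...(x+6)\<close>. What
  remains is \<open>(x+1)(x+5)/(x+6)\<close>, the source of the parameters 1/6 and 5/6.\<close>

lemma num_fpf_pairs_6:
  "6 * real (Suc l) * (num_fpf_pairs (6 * Suc l) / fact (6 * Suc l)) =
     (6 * real l + 1) * (6 * real l + 5) * (num_fpf_pairs (6 * l) / fact (6 * l))"
proof -
  have i6: "num_fpf_involutions (Suc (Suc (Suc (Suc (Suc (Suc n)))))) =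
      (n + 5) * ((n + 3) * ((n + 1) * num_fpf_involutions n))"
    and o6: "num_fpf_order_3 (Suc (Suc (Suc (Suc (Suc (Suc n)))))) =
      (n + 5) * (n + 4) * ((n + 2) * (n + 1) * num_fpf_order_3 n)"
    and f6: "fact (Suc (Suc (Suc (Suc (Suc (Suc n)))))) = real (n + 6) * (real (n + 5) *
      (real (n + 4) * (real (n + 3) * (real (n + 2) * (real (n + 1) * fact n)))))" for n
  proof -
    have e: "Suc (Suc (Suc (Suc n))) + 1 = n + 5" "Suc (Suc n) + 1 = n + 3"
      "Suc (Suc (Suc n)) + 2 = n + 5" "Suc (Suc (Suc n)) + 1 = n + 4" by simp_all
    show "num_fpf_involutions (Suc (Suc (Suc (Suc (Suc (Suc n)))))) =
      (n + 5) * ((n + 3) * ((n + 1) * num_fpf_involutions n))"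
      by (simp only: num_fpf_involutions.simps e)
    show "num_fpf_order_3 (Suc (Suc (Suc (Suc (Suc (Suc n)))))) =
      (n + 5) * (n + 4) * ((n + 2) * (n + 1) * num_fpf_order_3 n)"
      by (simp only: num_fpf_order_3.simps e)
  qed (simp add: add_ac)
  have 6: "6 * Suc l = Suc (Suc (Suc (Suc (Suc (Suc (6 * l))))))" by simp
  have p: "num_fpf_pairs (6 * Suc l) = (6 * l + 5) * (6 * l + 3) * (6 * l + 1) *
      ((6 * l + 5) * (6 * l + 4) * (6 * l + 2) * (6 * l + 1)) * num_fpf_pairs (6 * l)"
    unfolding num_fpf_pairs_def 6 i6 o6 by (simp only: mult_ac)
  have f: "fact (6 * Suc l) = real (6 * l + 6) * (real (6 * l + 5) * (real (6 * l + 4) *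
      (real (6 * l + 3) * (real (6 * l + 2) * (real (6 * l + 1) * fact (6 * l))))))"
    unfolding 6 f6 ..
  have "6 * (x + 1) * ((6*x+5)*(6*x+3)*(6*x+1)*((6*x+5)*(6*x+4)*(6*x+2)*(6*x+1))*p /
      ((6*x+6)*((6*x+5)*((6*x+4)*((6*x+3)*((6*x+2)*((6*x+1)*f))))))) = (6*x+1)*(6*x+5)*(p/f)"
    if "x \<ge> 0" "f > 0" for x p f :: real
    using that by (simp add: divide_simps add_nonneg_eq_0_iff)
  from this[of "real l" "fact (6 * l)" "num_fpf_pairs (6 * l)"]
  show ?thesis
    unfolding p f of_nat_mult of_nat_add of_nat_numeral of_nat_1 of_nat_Suc add.commute[of 1 "real l"]
    by simp
qed

text \<open>Counts the placements of a coset space inside \<open>A\<close> with the trivial coset at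
  the base point.\<close>

lemma card_pointed_injections:
  assumes R: "finite R" "r \<in> R" and A: "finite A" "a \<in> A" and le: "card R \<le> card A"
  shows "finite {\<beta> \<in> R \<rightarrow>\<^sub>E A. inj_on \<beta> R \<and> \<beta> r = a}"
    and "card {\<beta> \<in> R \<rightarrow>\<^sub>E A. inj_on \<beta> R \<and> \<beta> r = a} * fact (card A - card R) = fact (card A - 1)"
proof -
  let ?I = "{\<beta> \<in> R \<rightarrow>\<^sub>E A. inj_on \<beta> R \<and> \<beta> r = a}"
  let ?J = "{\<beta> \<in> (R - {r}) \<rightarrow>\<^sub>E (A - {a}). inj_on \<beta> (R - {r})}"
  show "finite ?I" using R A by (auto intro!: finite_subset[OF _ finite_PiE[of R "\<lambda>_. A"]])
  have "bij_betw (\<lambda>\<beta>. \<beta>(r := undefined)) ?I ?J"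
  proof (rule bij_betw_byWitness[of _ "\<lambda>\<beta>. \<beta>(r := a)"])
    show "\<forall>\<beta>\<in>?J. (\<beta>(r := a))(r := undefined) = \<beta>"
      by (auto simp: fun_eq_iff PiE_def extensional_def)
    show "(\<lambda>\<beta>. \<beta>(r := undefined)) ` ?I \<subseteq> ?J"
      using R by (auto simp: PiE_def extensional_def inj_on_def Pi_def)
    show "(\<lambda>\<beta>. \<beta>(r := a)) ` ?J \<subseteq> ?I"
      using R A by (fastforce simp: PiE_def extensional_def inj_on_def Pi_def)
  qed auto
  then have "card ?I = card ?J" by (rule bij_betw_same_card)
  also have "\<dots> = (\<Prod>i = 0..<card R - 1. card A - 1 - i)"
    using card_inj_on_subset_funcset[of "R - {r}" "A - {a}" "R - {r}"] R A by simp
  finally have I: "card ?I = (\<Prod>i = 0..<card R - 1. card A - 1 - i)" .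
  have "(\<Prod>i = 0..<k. n - i) * fact (n - k) = (fact n :: nat)" if "k \<le> n" for k n :: nat
    using that
  proof (induction k)
    case (Suc k)
    then have "fact (n - k) = (n - k) * (fact (n - Suc k) :: nat)"
      by (metis Suc_diff_Suc Suc_le_lessD fact_Suc of_nat_id)
    then show ?case using Suc by (simp add: mult_ac)
  qed simp
  from this[of "card R - 1" "card A - 1"]
  have "card ?I * fact (card A - 1 - (card R - 1)) = fact (card A - 1)"
    using le I by simp
  moreover have "card A - 1 - (card R - 1) = card A - card R"
    using R le card_gt_0_iff[of R] by auto
  ultimately show "card ?I * fact (card A - card R) = fact (card A - 1)" by simp
qed

section \<open>Counting free subgroups\<close>

definition glue :: "'c set \<Rightarrow> ('c \<Rightarrow> 'x) \<Rightarrow> ('c \<Rightarrow> 'c) \<Rightarrow> ('x \<Rightarrow> 'x) \<Rightarrow> 'x \<Rightarrow> 'x" where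
  "glue R \<beta> \<sigma> s = (\<lambda>y. if y \<in> \<beta> ` R then \<beta> (\<sigma> (inv_into R \<beta> y)) else s y)"

lemma glue_inside: "inj_on \<beta> R \<Longrightarrow> C \<in> R \<Longrightarrow> glue R \<beta> \<sigma> s (\<beta> C) = \<beta> (\<sigma> C)"
  by (simp add: glue_def)

lemma glue_outside: "y \<notin> \<beta> ` R \<Longrightarrow> glue R \<beta> \<sigma> s y = s y"
  by (simp add: glue_def)

lemma glue_fpf_involution:
  assumes \<beta>: "inj_on \<beta> R" "\<beta> ` R \<subseteq> A" and s: "s \<in> fpf_involutions (A - \<beta> ` R)"
    and \<sigma>: "\<And>C. C \<in> R \<Longrightarrow> \<sigma> C \<in> R \<and> \<sigma> C \<noteq> C \<and> \<sigma> (\<sigma> C) = C"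
  shows "glue R \<beta> \<sigma> s \<in> fpf_involutions A"
proof -
  have "glue R \<beta> \<sigma> s y \<in> A \<and> glue R \<beta> \<sigma> s y \<noteq> y \<and> glue R \<beta> \<sigma> s (glue R \<beta> \<sigma> s y) = y"
    if y: "y \<in> A" for y
  proof (cases "y \<in> \<beta> ` R")
    case True
    then obtain C where C: "C \<in> R" "y = \<beta> C" by blast
    then show ?thesis using \<sigma>[OF C(1)] \<beta> by (auto simp: glue_inside inj_on_eq_iff)
  next
    case False
    then have "s y \<in> A - \<beta> ` R" "s y \<noteq> y" "s (s y) = y" using s y by (auto simp: fpf_involutions_def)
    then show ?thesis using False by (simp add: glue_outside)
  qed
  moreover have "glue R \<beta> \<sigma> s y = y" if "y \<notin> A" for y
    using that s \<beta>(2) by (subst glue_outside) (auto simp: fpf_involutions_def)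
  ultimately show ?thesis by (simp add: fpf_involutions_def)
qed

lemma glue_fpf_order_3:
  assumes \<beta>: "inj_on \<beta> R" "\<beta> ` R \<subseteq> A" and u: "u \<in> fpf_order_3 (A - \<beta> ` R)"
    and \<tau>: "\<And>C. C \<in> R \<Longrightarrow> \<tau> C \<in> R \<and> \<tau> C \<noteq> C \<and> \<tau> (\<tau> (\<tau> C)) = C"
  shows "glue R \<beta> \<tau> u \<in> fpf_order_3 A"
proof -
  have "glue R \<beta> \<tau> u y \<in> A \<and> glue R \<beta> \<tau> u y \<noteq> y \<and>
      glue R \<beta> \<tau> u (glue R \<beta> \<tau> u (glue R \<beta> \<tau> u y)) = y" if y: "y \<in> A" for y
  proof (cases "y \<in> \<beta> ` R")
    case True
    then obtain C where C: "C \<in> R" "y = \<beta> C" by blast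
    then show ?thesis using \<tau>[OF C(1)] \<tau>[of "\<tau> C"] \<beta> by (auto simp: glue_inside inj_on_eq_iff)
  next
    case False
    then have "u y \<in> A - \<beta> ` R" "u y \<noteq> y" "u (u (u y)) = y" "u (u y) \<in> A - \<beta> ` R"
      using u y by (auto simp: fpf_order_3_def)
    then show ?thesis using False by (simp add: glue_outside)
  qed
  moreover have "glue R \<beta> \<tau> u y = y" if "y \<notin> A" for y
    using that u \<beta>(2) by (subst glue_outside) (auto simp: fpf_order_3_def)
  ultimately show ?thesis by (simp add: fpf_order_3_def)
qed

lemma fpf_pairs_act23: "(s, u) \<in> fpf_pairs A \<Longrightarrow> act23 A s u"
  by (auto simp: fpf_pairs_def fpf_involutions_def fpf_order_3_def act23_def)

context free_product_2_3
begin

definition free_index :: "nat \<Rightarrow> 'a set set" where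
  "free_index k = {H. subgroup H G \<and> free_group (G\<lparr>carrier := H\<rparr>) \<and> card (rcosets H) = k}"

lemma orbit_map:
  assumes act: "act23 X s u" and x: "x \<in> X"
  shows "\<exists>\<beta>. (\<forall>w. \<beta> (stab s u x #> ev w) = word_act s u w x) \<and>
    inj_on \<beta> (rcosets (stab s u x)) \<and> \<beta> \<in> rcosets (stab s u x) \<rightarrow>\<^sub>E X \<and>
    (\<forall>C\<in>rcosets (stab s u x). \<beta> (C #> S) = s (\<beta> C) \<and> \<beta> (C #> U) = u (\<beta> C))"
proof -
  let ?H = "stab s u x"
  have HG: "?H \<subseteq> carrier G" by (auto simp: stab_def)
  \<comment> \<open>The image of a coset is read off from any representing word. The restriction
    makes \<open>\<beta>\<close> extensional, so that it lies in the set of injections that is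
    counted.\<close>
  define \<beta> where "\<beta> = restrict (\<lambda>C. word_act s u (SOME w. C = ?H #> ev w) x) (rcosets ?H)"
  have \<beta>: "\<beta> (?H #> ev w) = word_act s u w x" for w
  proof -
    have "?H #> ev w = ?H #> ev (SOME v. ?H #> ev w = ?H #> ev v)" by (rule someI) simp
    then show ?thesis using rcoset_stab_eq_iff[OF act x] HG by (simp add: \<beta>_def rcosetsI)
  qed
  show ?thesis
  proof (intro exI[of _ \<beta>] conjI ballI allI)
    show "inj_on \<beta> (rcosets ?H)"
      using rcoset_stab_eq_iff[OF act x] by (auto simp: inj_on_def rcosets_eq \<beta>)
    show "\<beta> \<in> rcosets ?H \<rightarrow>\<^sub>E X"
      using act23_word_act[OF act x] by (auto simp: \<beta>_def)
    fix C assume "C \<in> rcosets ?H"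
    then obtain w where C: "C = ?H #> ev w" by (auto simp: rcosets_eq)
    have "C #> S = ?H #> ev (w @ [True])" "C #> U = ?H #> ev (w @ [False])"
      by (simp_all add: C coset_mult_assoc HG)
    then show "\<beta> (C #> S) = s (\<beta> C)" "\<beta> (C #> U) = u (\<beta> C)"
      by (simp_all add: \<beta> C del: ev_append)
  qed (rule \<beta>)
qed

text \<open>The coset space embeds equivariantly into \<open>A\<close> as the orbit of
  \<open>x\<close>; a fixed coset would give a fixed point in \<open>A\<close>.\<close>

lemma stab_in_free_index:
  assumes A: "finite A" "x \<in> A" and su: "(s, u) \<in> fpf_pairs A"
  shows "stab s u x \<in> free_index (card (rcosets (stab s u x)))"
    and "card (rcosets (stab s u x)) \<in> {1..card A}"
proof -
  let ?H = "stab s u x"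
  have act: "act23 A s u" using su by (rule fpf_pairs_act23)
  have H: "subgroup ?H G" by (rule subgroup_stab[OF act A(2)])
  obtain \<beta> where "\<And>w. \<beta> (?H #> ev w) = word_act s u w x"
    and \<beta>: "inj_on \<beta> (rcosets ?H)" "\<beta> \<in> rcosets ?H \<rightarrow>\<^sub>E A"
    "\<And>C. C \<in> rcosets ?H \<Longrightarrow> \<beta> (C #> S) = s (\<beta> C) \<and> \<beta> (C #> U) = u (\<beta> C)"
    using orbit_map[OF act A(2)] by blast
  have \<beta>A: "\<beta> ` (rcosets ?H) \<subseteq> A" using \<beta>(2) by auto
  have fin: "finite (rcosets ?H)" using \<beta>(1) \<beta>A A(1) by (metis finite_imageD finite_subset)
  have "C #> S \<noteq> C" "C #> U \<noteq> C" if "C \<in> rcosets ?H" for C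
  proof -
    have "\<beta> C \<in> A" using \<beta>A that by blast
    then have "s (\<beta> C) \<noteq> \<beta> C" "u (\<beta> C) \<noteq> \<beta> C"
      using su by (auto simp: fpf_pairs_def fpf_involutions_def fpf_order_3_def)
    then show "C #> S \<noteq> C" "C #> U \<noteq> C" using \<beta>(3)[OF that] by auto
  qed
  then show "?H \<in> free_index (card (rcosets ?H))"
    using fixed_point_free_imp_free[OF H fin] H by (simp add: free_index_def)
  have "card (rcosets ?H) \<le> card A" using card_inj_on_le[OF \<beta>(1) \<beta>A A(1)] .
  moreover have "rcosets ?H \<noteq> {}" by (simp add: rcosets_eq)
  ultimately show "card (rcosets ?H) \<in> {1..card A}" using fin by (simp add: Suc_le_eq card_gt_0_iff)
qed

text \<open>A pair with stabilizer \<open>H\<close> at \<open>x\<close> consists of two independent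
  data: the orbit of \<open>x\<close>, a copy of the coset space of \<open>H\<close> with
  \<open>H\<close> placed at \<open>x\<close>, and a fixed-point-free pair on the complement of that
  orbit.\<close>

lemma stab_fibre_bij:
  fixes A :: "'x set"
  assumes A: "finite A" "x \<in> A" and H: "H \<in> free_index k"
  defines "B \<equiv> {\<beta> \<in> rcosets H \<rightarrow>\<^sub>E A. inj_on \<beta> (rcosets H) \<and> \<beta> H = x}"
  shows "bij_betw (\<lambda>(\<beta>, s, u). (glue (rcosets H) \<beta> (\<lambda>C. C #> S) s, glue (rcosets H) \<beta> (\<lambda>C. C #> U) u))
    (SIGMA \<beta>:B. fpf_pairs (A - \<beta> ` (rcosets H))) {p \<in> fpf_pairs A. stab (fst p) (snd p) x = H}"
    (is "bij_betw ?g ?D ?T")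
proof -
  let ?R = "rcosets H" and ?\<sigma> = "\<lambda>C. C #> S" and ?\<tau> = "\<lambda>C. C #> U"
  have sub: "subgroup H G" and free: "free_group (G\<lparr>carrier := H\<rparr>)" using H by (auto simp: free_index_def)
  have HG: "H \<subseteq> carrier G" using sub by (rule subgroup.subset)
  have HR: "H \<in> ?R" using sub by (simp add: subgroup.subgroup_in_rcosets is_group)
  have act: "act23 ?R ?\<sigma> ?\<tau>" by (rule act23_rcosets[OF HG])
  have \<sigma>: "C #> S \<in> ?R \<and> C #> S \<noteq> C \<and> C #> S #> S = C" if "C \<in> ?R" for C
    using act free_imp_fixed_point_free[OF sub free that] that by (simp add: act23_def)
  have \<tau>: "C #> U \<in> ?R \<and> C #> U \<noteq> C \<and> C #> U #> U #> U = C" if "C \<in> ?R" for C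
    using act free_imp_fixed_point_free[OF sub free that] that by (simp add: act23_def)
  have wact: "word_act (glue ?R \<beta> ?\<sigma> s) (glue ?R \<beta> ?\<tau> u) w (\<beta> C) = \<beta> (word_act ?\<sigma> ?\<tau> w C)"
    if "inj_on \<beta> ?R" "C \<in> ?R" for \<beta> :: "'a set \<Rightarrow> 'x" and s u w C
    using that(2)
  proof (induction w arbitrary: C)
    case (Cons b w)
    then show ?case using glue_inside[OF that(1)] \<sigma> \<tau> by simp
  qed simp
  have wact_H: "word_act (glue ?R \<beta> ?\<sigma> s) (glue ?R \<beta> ?\<tau> u) w x = \<beta> (H #> ev w)" if "\<beta> \<in> B" for \<beta> s u w
  proof -
    have "word_act ?\<sigma> ?\<tau> w H = H #> ev w"
      using word_act_rcoset[OF HG one_closed, of w] HG by simp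
    then show ?thesis using wact[of \<beta> H s u w] that HR by (auto simp: B_def)
  qed
  have into: "?g ` ?D \<subseteq> ?T"
  proof (rule image_subsetI)
    fix p assume "p \<in> ?D"
    then obtain \<beta> s u where p: "p = (\<beta>, s, u)" and \<beta>: "\<beta> \<in> B"
      and su: "s \<in> fpf_involutions (A - \<beta> ` ?R)" "u \<in> fpf_order_3 (A - \<beta> ` ?R)"
      by (auto simp: fpf_pairs_def)
    have b: "inj_on \<beta> ?R" "\<beta> ` ?R \<subseteq> A" "\<beta> H = x" using \<beta> by (auto simp: B_def)
    have "ev w \<in> stab (glue ?R \<beta> ?\<sigma> s) (glue ?R \<beta> ?\<tau> u) x \<longleftrightarrow> ev w \<in> H" for w
    proof -
      have pair: "(glue ?R \<beta> ?\<sigma> s, glue ?R \<beta> ?\<tau> u) \<in> fpf_pairs A"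
        unfolding fpf_pairs_def using glue_fpf_involution[OF b(1,2) su(1) \<sigma>] glue_fpf_order_3[OF b(1,2) su(2) \<tau>] by blast
      have "ev w \<in> stab (glue ?R \<beta> ?\<sigma> s) (glue ?R \<beta> ?\<tau> u) x \<longleftrightarrow> \<beta> (H #> ev w) = \<beta> H"
        using ev_in_stab_iff[OF fpf_pairs_act23[OF pair] A(2)] wact_H[OF \<beta>] b(3) by simp
      also have "\<dots> \<longleftrightarrow> H #> ev w = H"
        using b(1) HR HG by (simp add: inj_on_eq_iff rcosetsI)
      also have "\<dots> \<longleftrightarrow> ev w \<in> H"
        using sub by (metis coset_join1 coset_join2 HG ev_closed)
      finally show ?thesis .
    qed
    moreover have "\<exists>w. g = ev w" if "g \<in> H \<or> g \<in> stab (glue ?R \<beta> ?\<sigma> s) (glue ?R \<beta> ?\<tau> u) x" for g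
      using that generated HG by (auto simp: stab_def)
    ultimately have "stab (glue ?R \<beta> ?\<sigma> s) (glue ?R \<beta> ?\<tau> u) x = H" by blast
    then show "?g p \<in> ?T"
      using glue_fpf_involution[OF b(1,2) su(1) \<sigma>] glue_fpf_order_3[OF b(1,2) su(2) \<tau>]
      by (simp add: p fpf_pairs_def)
  qed
  have inj: "inj_on ?g ?D"
  proof (rule inj_onI)
    fix p p' assume "p \<in> ?D" "p' \<in> ?D" and eq: "?g p = ?g p'"
    then obtain \<beta> s u \<beta>' s' u' where p: "p = (\<beta>, s, u)" "p' = (\<beta>', s', u')" and \<beta>: "\<beta> \<in> B" "\<beta>' \<in> B"
      and su: "s \<in> fpf_involutions (A - \<beta> ` ?R)" "u \<in> fpf_order_3 (A - \<beta> ` ?R)"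
      "s' \<in> fpf_involutions (A - \<beta>' ` ?R)" "u' \<in> fpf_order_3 (A - \<beta>' ` ?R)"
      by (auto simp: fpf_pairs_def)
    have g: "glue ?R \<beta> ?\<sigma> s = glue ?R \<beta>' ?\<sigma> s'" "glue ?R \<beta> ?\<tau> u = glue ?R \<beta>' ?\<tau> u'"
      using eq by (auto simp: p)
    have "\<beta> (H #> ev w) = \<beta>' (H #> ev w)" for w
      using wact_H[OF \<beta>(1), of s u w] wact_H[OF \<beta>(2), of s' u' w] g by simp
    then have "\<beta> C = \<beta>' C" if "C \<in> ?R" for C using that by (auto simp: rcosets_eq)
    then have bb: "\<beta> = \<beta>'"
      using \<beta> by (intro PiE_ext[of \<beta> ?R "\<lambda>_. A" \<beta>']) (auto simp: B_def)
    have "s y = s' y" "u y = u' y" for y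
    proof -
      show "s y = s' y"
      proof (cases "y \<in> \<beta> ` ?R")
        case True
        then show ?thesis using su(1,3) bb by (simp add: fpf_involutions_def)
      next
        case False
        then show ?thesis using fun_cong[OF g(1), of y] bb by (simp add: glue_outside)
      qed
      show "u y = u' y"
      proof (cases "y \<in> \<beta> ` ?R")
        case True
        then show ?thesis using su(2,4) bb by (simp add: fpf_order_3_def)
      next
        case False
        then show ?thesis using fun_cong[OF g(2), of y] bb by (simp add: glue_outside)
      qed
    qed
    then show "p = p'" using bb by (auto simp: p)
  qed
  have "?T \<subseteq> ?g ` ?D"
  proof
    fix p assume "p \<in> ?T"
    then obtain s u where p: "p = (s, u)" and su: "(s, u) \<in> fpf_pairs A" and st: "stab s u x = H" by (cases p) auto
    have a: "act23 A s u" using su by (rule fpf_pairs_act23)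
    obtain \<beta> where \<beta>: "\<And>w. \<beta> (H #> ev w) = word_act s u w x" "inj_on \<beta> ?R" "\<beta> \<in> ?R \<rightarrow>\<^sub>E A"
      "\<And>C. C \<in> ?R \<Longrightarrow> \<beta> (C #> S) = s (\<beta> C) \<and> \<beta> (C #> U) = u (\<beta> C)"
      using orbit_map[OF a A(2), unfolded st] by blast
    have "\<beta> H = x" using \<beta>(1)[of "[]"] HG by simp
    then have \<beta>B: "\<beta> \<in> B" using \<beta> by (simp add: B_def)
    \<comment> \<open>Surjectivity: \<open>s'\<close> and \<open>u'\<close> are the restrictions to
      the complement of the orbit, made the identity elsewhere.\<close>
    define s' where "s' = (\<lambda>y. if y \<in> A - \<beta> ` ?R then s y else y)"
    define u' where "u' = (\<lambda>y. if y \<in> A - \<beta> ` ?R then u y else y)"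
    have su': "s y \<in> A" "s y \<noteq> y" "s (s y) = y" "u y \<in> A" "u y \<noteq> y" "u (u (u y)) = y" if "y \<in> A" for y
      using su that by (auto simp: fpf_pairs_def fpf_involutions_def fpf_order_3_def)
    have out: "s y = y" "u y = y" if "y \<notin> A" for y
      using su that by (auto simp: fpf_pairs_def fpf_involutions_def fpf_order_3_def)
    have s_in: "s y \<in> \<beta> ` ?R" "u y \<in> \<beta> ` ?R" if "y \<in> \<beta> ` ?R" for y
      using that \<beta>(4) \<sigma> \<tau> by (metis (no_types, lifting) image_iff)+
    have s_out: "s y \<notin> \<beta> ` ?R" if "y \<in> A" "y \<notin> \<beta> ` ?R" for y
      using s_in(1)[of "s y"] su'[OF that(1)] that(2) by auto
    \<comment> \<open>From \<open>u y\<close> in the orbit, two further steps of \<open>u\<close>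
      would lead back to \<open>y\<close>.\<close>
    have u_out: "u y \<notin> \<beta> ` ?R" if "y \<in> A" "y \<notin> \<beta> ` ?R" for y
      using s_in(2)[of "u y"] s_in(2)[of "u (u y)"] su'[OF that(1)] that(2) by auto
    have "s' \<in> fpf_involutions (A - \<beta> ` ?R)"
      using su' s_out by (simp add: fpf_involutions_def s'_def)
    moreover have "u' \<in> fpf_order_3 (A - \<beta> ` ?R)"
      using su' u_out by (simp add: fpf_order_3_def u'_def)
    ultimately have D: "(\<beta>, s', u') \<in> ?D" using \<beta>B by (simp add: fpf_pairs_def)
    have \<beta>A: "\<beta> ` ?R \<subseteq> A" using \<beta>(3) by auto
    have "glue ?R \<beta> ?\<sigma> s' y = s y" "glue ?R \<beta> ?\<tau> u' y = u y" for y
    proof -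
      have "glue ?R \<beta> ?\<sigma> s' y = s y \<and> glue ?R \<beta> ?\<tau> u' y = u y"
      proof (cases "y \<in> \<beta> ` ?R")
        case True
        then obtain C where "C \<in> ?R" "y = \<beta> C" by blast
        then show ?thesis using \<beta>(2,4) by (simp add: glue_inside)
      next
        case False
        then show ?thesis using out by (simp add: glue_outside s'_def u'_def)
      qed
      then show "glue ?R \<beta> ?\<sigma> s' y = s y" "glue ?R \<beta> ?\<tau> u' y = u y" by auto
    qed
    then have gp: "?g (\<beta>, s', u') = p" by (auto simp: p fun_eq_iff)
    show "p \<in> ?g ` ?D" using imageI[OF D, of ?g] by (simp only: gp)
  qed
  then show ?thesis using inj into by (auto simp: bij_betw_def)
qed

lemma stab_fibre_card:
  assumes A: "finite A" "x \<in> A" and H: "H \<in> free_index k" and k: "1 \<le> k" "k \<le> card A"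
  shows "card {p \<in> fpf_pairs A. stab (fst p) (snd p) x = H} * fact (card A - k) =
    fact (card A - 1) * num_fpf_pairs (card A - k)"
proof -
  let ?R = "rcosets H"
  have R: "card ?R = k" "finite ?R" using H k by (auto simp: free_index_def intro: card_ge_0_finite)
  have HR: "H \<in> ?R" using H by (simp add: free_index_def subgroup.subgroup_in_rcosets is_group)
  let ?B = "{\<beta> \<in> ?R \<rightarrow>\<^sub>E A. inj_on \<beta> ?R \<and> \<beta> H = x}"
  have B: "finite ?B" "card ?B * fact (card A - k) = fact (card A - 1)"
    using card_pointed_injections[OF R(2) HR A] k R(1) by auto
  have fib: "card (fpf_pairs (A - \<beta> ` ?R)) = num_fpf_pairs (card A - k)" if "\<beta> \<in> ?B" for \<beta>
  proof -
    have "\<beta> ` ?R \<subseteq> A" using that by auto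
    then have "card (A - \<beta> ` ?R) = card A - card (\<beta> ` ?R)"
      using A(1) by (intro card_Diff_subset) (auto intro: finite_subset)
    also have "card (\<beta> ` ?R) = k" using that R(1) by (simp add: card_image)
    finally show ?thesis using fpf_pairs_card(2)[of "A - \<beta> ` ?R"] A(1) by simp
  qed
  have "card {p \<in> fpf_pairs A. stab (fst p) (snd p) x = H} = card (SIGMA \<beta>:?B. fpf_pairs (A - \<beta> ` ?R))"
    using bij_betw_same_card[OF stab_fibre_bij[OF A H]] by simp
  also have "\<dots> = (\<Sum>\<beta>\<in>?B. card (fpf_pairs (A - \<beta> ` ?R)))"
    using B(1) fpf_pairs_card(1) A(1) by (intro card_SigmaI) auto
  also have "\<dots> = (\<Sum>\<beta>\<in>?B. num_fpf_pairs (card A - k))" by (intro sum.cong refl fib)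
  also have "\<dots> = card ?B * num_fpf_pairs (card A - k)" by simp
  finally show ?thesis by (simp only: B(2)[symmetric] mult_ac)
qed

text \<open>On exactly \<open>k\<close> points the action must be transitive, and the fibre over
  \<open>H\<close> has \<open>fact (k - 1)\<close> elements, so it is nonempty. This bounds the
  number of free subgroups and excludes indices not divisible by 6.\<close>

lemma free_index_stab:
  assumes "1 \<le> k" "H \<in> free_index k"
  shows "\<exists>p \<in> fpf_pairs {..<k}. stab (fst p) (snd p) 0 = H"
proof -
  have "card {p \<in> fpf_pairs {..<k}. stab (fst p) (snd p) 0 = H} = fact (k - 1)"
    using stab_fibre_card[of "{..<k}" 0 H k] assms by (simp add: num_fpf_pairs_def)
  then have "{p \<in> fpf_pairs {..<k}. stab (fst p) (snd p) 0 = H} \<noteq> {}"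
    by (metis card.empty fact_nonzero)
  then show ?thesis by blast
qed

lemma finite_free_index: "1 \<le> k \<Longrightarrow> finite (free_index k)"
  using free_index_stab fpf_pairs_card(1)[of "{..<k}"]
  by (intro finite_surj[of "fpf_pairs {..<k}" _ "\<lambda>p. stab (fst p) (snd p) 0"]) auto

lemma free_index_empty:
  assumes "1 \<le> k" "\<not> 6 dvd k"
  shows "free_index k = {}"
proof -
  have "card (fpf_pairs {..<k}) = 0" using fpf_pairs_card(2)[of "{..<k}"] num_fpf_pairs_not_dvd assms by simp
  then have "fpf_pairs {..<k} = {}" using fpf_pairs_card(1)[of "{..<k}"] by simp
  then show ?thesis using free_index_stab[OF assms(1)] by blast
qed

text \<open>The fibre over a subgroup depends only on its index and contributes
  \<open>fact (n - 1)\<close>; normalising by \<open>fact n\<close> instead leaves the factor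
  \<open>n\<close>.\<close>

lemma num_fpf_pairs_convolution:
  assumes n: "n \<ge> 1"
  shows "real n * (num_fpf_pairs n / fact n) =
    (\<Sum>k=1..n. card (free_index k) * (num_fpf_pairs (n - k) / fact (n - k)))"
proof -
  let ?A = "{..<n}" and ?F = "\<Union>k\<in>{1..n}. free_index k"
  let ?fib = "\<lambda>H. {p \<in> fpf_pairs ?A. stab (fst p) (snd p) 0 = H}"
  have 0: "finite ?A" "0 \<in> ?A" using n by auto
  have finA: "finite (fpf_pairs ?A)" by (rule fpf_pairs_card) simp
  have "fpf_pairs ?A \<subseteq> (\<Union>H\<in>?F. ?fib H)"
  proof
    fix p assume p: "p \<in> fpf_pairs ?A"
    then have "stab (fst p) (snd p) 0 \<in> ?F"
      using stab_in_free_index[OF 0, of "fst p" "snd p"] by force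
    then show "p \<in> (\<Union>H\<in>?F. ?fib H)" using p by blast
  qed
  then have "fpf_pairs ?A = (\<Union>H\<in>?F. ?fib H)" by blast
  then have "num_fpf_pairs n = card (\<Union>H\<in>?F. ?fib H)"
    using fpf_pairs_card(2)[OF 0(1)] by simp
  also have "\<dots> = (\<Sum>H\<in>?F. card (?fib H))"
    using finA finite_free_index by (intro card_UN_disjoint) auto
  also have "\<dots> = (\<Sum>k=1..n. \<Sum>H\<in>free_index k. card (?fib H))"
    using finite_free_index by (intro sum.UNION_disjoint) (auto simp: free_index_def)
  finally have "real (num_fpf_pairs n) = (\<Sum>k=1..n. \<Sum>H\<in>free_index k. real (card (?fib H)))"
    by simp
  also have "\<dots> = (\<Sum>k=1..n. \<Sum>H\<in>free_index k. fact (n - 1) * (num_fpf_pairs (n - k) / fact (n - k)))"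
  proof (intro sum.cong refl)
    fix k H assume "k \<in> {1..n}" "H \<in> free_index k"
    then have "card (?fib H) * fact (n - k) = fact (n - 1) * num_fpf_pairs (n - k)"
      using stab_fibre_card[OF 0, of H k] by simp
    then have "real (card (?fib H) * fact (n - k)) = real (fact (n - 1) * num_fpf_pairs (n - k))"
      by (simp only:)
    then have "real (card (?fib H)) * fact (n - k) = fact (n - 1) * num_fpf_pairs (n - k)"
      by (simp only: of_nat_mult of_nat_fact)
    then show "real (card (?fib H)) = fact (n - 1) * (num_fpf_pairs (n - k) / fact (n - k))"
      by (simp add: field_simps)
  qed
  also have "\<dots> = fact (n - 1) * (\<Sum>k=1..n. card (free_index k) * (num_fpf_pairs (n - k) / fact (n - k)))"
    by (simp add: sum_distrib_left mult_ac)
  finally have "real (num_fpf_pairs n) = \<dots>" .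
  moreover have "(fact n :: real) = real n * fact (n - 1)" using n by (simp add: fact_reduce)
  ultimately show ?thesis using n by simp
qed

lemma num_fpf_pairs_convolution_6:
  assumes "l \<ge> 1"
  shows "6 * real l * (num_fpf_pairs (6 * l) / fact (6 * l)) =
    (\<Sum>k=1..l. card (free_index (6 * k)) * (num_fpf_pairs (6 * (l - k)) / fact (6 * (l - k))))"
proof -
  let ?f = "\<lambda>k. card (free_index k) * (num_fpf_pairs (6 * l - k) / fact (6 * l - k))"
  have "6 * real l * (num_fpf_pairs (6 * l) / fact (6 * l)) = (\<Sum>k=1..6*l. ?f k)"
    using num_fpf_pairs_convolution[of "6 * l"] assms by simp
  also have "\<dots> = (\<Sum>k\<in>(*) 6 ` {1..l}. ?f k)"
  proof (rule sum.mono_neutral_right)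
    show "\<forall>k\<in>{1..6 * l} - (*) 6 ` {1..l}. ?f k = 0"
    proof
      fix k assume k: "k \<in> {1..6 * l} - (*) 6 ` {1..l}"
      have "\<not> 6 dvd k"
      proof
        assume "6 dvd k"
        then obtain j where "k = 6 * j" by (auto simp: dvd_def)
        then show False using k by auto
      qed
      then show "?f k = 0" using free_index_empty[of k] k by simp
    qed
  qed auto
  also have "\<dots> = (\<Sum>k=1..l. ?f (6 * k))" by (subst sum.reindex) (auto simp: inj_on_def)
  finally show ?thesis by (simp only: diff_mult_distrib2)
qed

end

section \<open>The modular group\<close>

definition mk2 :: "int \<Rightarrow> int \<Rightarrow> int \<Rightarrow> int \<Rightarrow> int^2^2" where
  "mk2 a b c d = vector [vector [a, b], vector [c, d]]"

lemma mk2_nth [simp]: "mk2 a b c d $ 1 $ 1 = a" "mk2 a b c d $ 1 $ 2 = b"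
  "mk2 a b c d $ 2 $ 1 = c" "mk2 a b c d $ 2 $ 2 = d"
  by (simp_all add: mk2_def vector_2)

lemma mk2_eq_iff: "mk2 a b c d = mk2 a' b' c' d' \<longleftrightarrow> a = a' \<and> b = b' \<and> c = c' \<and> d = d'"
  by (auto simp: vec_eq_iff forall_2)

lemma mk2_exists: "\<exists>a b c d. A = mk2 a b c d"
  by (rule exI[of _ "A $ 1 $ 1"], rule exI[of _ "A $ 1 $ 2"], rule exI[of _ "A $ 2 $ 1"],
      rule exI[of _ "A $ 2 $ 2"]) (simp add: vec_eq_iff forall_2)

lemma mk2_mult: "mk2 a b c d ** mk2 a' b' c' d' =
    mk2 (a * a' + b * c') (a * b' + b * d') (c * a' + d * c') (c * b' + d * d')"
  by (simp add: vec_eq_iff forall_2 matrix_matrix_mult_def sum_2)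

lemma mk2_uminus: "- mk2 a b c d = mk2 (- a) (- b) (- c) (- d)"
  by (simp add: vec_eq_iff forall_2)

lemma mk2_one: "mat 1 = mk2 1 0 0 1"
  by (simp add: vec_eq_iff forall_2 mat_def)

lemma mk2_det: "det (mk2 a b c d) = a * d - b * c"
  by (simp add: det_2)

lemma matrix_minus_mult: "(- A) ** B = - (A ** B)" "A ** (- B) = - (A ** B)" for A B :: "int^2^2"
  by (simp_all add: vec_eq_iff matrix_matrix_mult_def sum_negf)

lemma group_SL2Z: "group SL2Z"
proof (rule groupI)
  fix A assume "A \<in> carrier SL2Z"
  moreover obtain a b c d where A: "A = mk2 a b c d" using mk2_exists by blast
  ultimately have "a * d - b * c = 1" by (simp add: SL2Z_def mk2_det)
  then show "\<exists>B\<in>carrier SL2Z. B \<otimes>\<^bsub>SL2Z\<^esub> A = \<one>\<^bsub>SL2Z\<^esub>"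
    by (intro bexI[of _ "mk2 d (- b) (- c) a"])
      (auto simp: SL2Z_def mk2_mult mk2_det mk2_one A mk2_eq_iff algebra_simps)
qed (auto simp: SL2Z_def det_mul matrix_mul_assoc det_I)

lemma det_uminus_2: "det (- A) = det (A :: int^2^2)"
  by (simp add: det_2)

lemma normal_center: "{mat 1, - mat 1} \<lhd> SL2Z"
proof -
  interpret group SL2Z by (rule group_SL2Z)
  have carr: "{mat 1, - mat 1} \<subseteq> carrier SL2Z" by (auto simp: SL2Z_def det_uminus_2 det_I)
  have sub: "subgroup {mat 1, - mat 1} SL2Z"
  proof (rule subgroupI[OF carr])
    fix A assume A: "A \<in> {mat 1, - mat 1 :: int^2^2}"
    then have "A \<otimes>\<^bsub>SL2Z\<^esub> A = \<one>\<^bsub>SL2Z\<^esub>" by (auto simp: SL2Z_def matrix_minus_mult)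
    then have "inv\<^bsub>SL2Z\<^esub> A = A" using A carr by (intro inv_equality) auto
    then show "inv\<^bsub>SL2Z\<^esub> A \<in> {mat 1, - mat 1}" using A by simp
  qed (auto simp: SL2Z_def matrix_minus_mult)
  show ?thesis
  proof (rule normalI[OF sub], rule ballI)
    fix A assume "A \<in> carrier SL2Z"
    then show "{mat 1, - mat 1} #>\<^bsub>SL2Z\<^esub> A = A <#\<^bsub>SL2Z\<^esub> {mat 1, - mat 1}"
      by (auto simp: r_coset_def l_coset_def SL2Z_def matrix_minus_mult)
  qed
qed

lemma group_PSL2Z: "group PSL2Z"
  unfolding PSL2Z_def by (rule normal.factorgroup_is_group[OF normal_center])

definition PSL_class :: "int^2^2 \<Rightarrow> (int^2^2) set" where
  "PSL_class A = {A, - A}"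

lemma PSL_class_eq_iff: "PSL_class A = PSL_class B \<longleftrightarrow> A = B \<or> A = - B"
  by (auto simp: PSL_class_def doubleton_eq_iff)

lemma PSL_class_coset: "{mat 1, - mat 1} #>\<^bsub>SL2Z\<^esub> A = PSL_class A"
  by (auto simp: r_coset_def SL2Z_def matrix_minus_mult PSL_class_def)

lemma PSL2Z_carrier: "carrier PSL2Z = PSL_class ` {A. det A = 1}"
  unfolding PSL2Z_def carrier_FactGroup PSL_class_coset by (simp add: SL2Z_def)

lemma PSL2Z_one: "\<one>\<^bsub>PSL2Z\<^esub> = PSL_class (mat 1)"
  by (simp add: PSL2Z_def FactGroup_def PSL_class_def)

lemma PSL2Z_mult: "det A = 1 \<Longrightarrow> det B = 1 \<Longrightarrow>
    PSL_class A \<otimes>\<^bsub>PSL2Z\<^esub> PSL_class B = PSL_class (A ** B)"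
  using normal.rcos_sum[OF normal_center, of A B, unfolded PSL_class_coset]
  by (simp add: PSL2Z_def FactGroup_def) (simp add: SL2Z_def)

text \<open>The traces 0 and 1 give \<open>S_mat\<close> the square and \<open>U_mat\<close> the
  cube \<open>- mat 1\<close>, hence orders 2 and 3 in the quotient.\<close>

abbreviation S_mat :: "int^2^2" where "S_mat \<equiv> mk2 0 (-1) 1 0"

abbreviation U_mat :: "int^2^2" where "U_mat \<equiv> mk2 0 (-1) 1 1"

primrec word_mat :: "bool list \<Rightarrow> int^2^2" where
  "word_mat [] = mat 1"
| "word_mat (b # w) = (if b then S_mat else U_mat) ** word_mat w"

lemma word_mat_append: "word_mat (v @ w) = word_mat v ** word_mat w"
  by (induction v) (auto simp: matrix_mul_assoc)

lemma det_word_mat: "det (word_mat w) = 1"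
  by (induction w) (auto simp: det_mul mk2_det det_I)

lemma word_eval_PSL2Z: "word_eval PSL2Z (PSL_class S_mat) (PSL_class U_mat) w = PSL_class (word_mat w)"
  by (induction w) (auto simp: word_eval_def PSL2Z_one PSL2Z_mult mk2_det det_word_mat)

section \<open>Generation of the modular group by the two matrices\<close>

definition word_mat_span :: "(int^2^2) set" where
  "word_mat_span = {A. \<exists>w. word_mat w = A \<or> word_mat w = - A}"

lemma word_mat_span_uminus: "- A \<in> word_mat_span \<longleftrightarrow> A \<in> word_mat_span"
  by (auto simp: word_mat_span_def)

lemma word_mat_span_mult:
  assumes "A \<in> word_mat_span"
  shows "S_mat ** A \<in> word_mat_span" "U_mat ** A \<in> word_mat_span"
proof -
  obtain w where "word_mat w = A \<or> word_mat w = - A" using assms by (auto simp: word_mat_span_def)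
  then have "word_mat (b # w) = (if b then S_mat else U_mat) ** A \<or>
      word_mat (b # w) = - ((if b then S_mat else U_mat) ** A)" for b
    by (auto simp: matrix_minus_mult)
  from this[of True] this[of False]
  show "S_mat ** A \<in> word_mat_span" "U_mat ** A \<in> word_mat_span"
    unfolding word_mat_span_def by (auto simp del: word_mat.simps)
qed

text \<open>Up to sign, \<open>S U\<close> is the translation that adds the second row to the first,
  and \<open>U U S\<close> is its inverse.\<close>

lemma word_mat_span_shift:
  assumes "mk2 a b c d \<in> word_mat_span"
  shows "mk2 (a + k * c) (b + k * d) c d \<in> word_mat_span"
proof (induction k rule: int_induct[where k = 0])
  case base
  then show ?case using assms by simp
next
  case (step1 k)
  have "S_mat ** (U_mat ** mk2 (a + k * c) (b + k * d) c d) \<in> word_mat_span"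
    by (intro word_mat_span_mult step1)
  also have "S_mat ** (U_mat ** mk2 (a + k * c) (b + k * d) c d) =
      - mk2 (a + (k + 1) * c) (b + (k + 1) * d) c d"
    by (simp add: mk2_mult mk2_uminus mk2_eq_iff algebra_simps)
  finally show ?case by (simp only: word_mat_span_uminus)
next
  case (step2 k)
  have "U_mat ** (U_mat ** (S_mat ** mk2 (a + k * c) (b + k * d) c d)) \<in> word_mat_span"
    by (intro word_mat_span_mult step2)
  also have "U_mat ** (U_mat ** (S_mat ** mk2 (a + k * c) (b + k * d) c d)) =
      - mk2 (a + (k - 1) * c) (b + (k - 1) * d) c d"
    by (simp add: mk2_mult mk2_uminus mk2_eq_iff algebra_simps)
  finally show ?case by (simp only: word_mat_span_uminus)
qed

text \<open>The Euclidean algorithm on the first column: a translation replaces \<open>a\<close> by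
  \<open>a mod c\<close>, and \<open>S_mat\<close> swaps the rows up to a sign.\<close>

lemma word_mat_span_det_1:
  "a * d - b * c = 1 \<Longrightarrow> mk2 a b c d \<in> word_mat_span"
proof (induction "nat \<bar>c\<bar>" arbitrary: a b c d rule: less_induct)
  case less
  have one: "mk2 1 0 0 1 \<in> word_mat_span"
    unfolding word_mat_span_def mk2_one[symmetric] by (auto intro: exI[of _ "[]"])
  show ?case
  proof (cases "c = 0")
    case True
    then have "a * d = 1" using less by simp
    then consider "a = 1" "d = 1" | "a = -1" "d = -1" by (auto simp: zmult_eq_1_iff)
    then show ?thesis
    proof cases
      case 1
      then show ?thesis using word_mat_span_shift[OF one, of b] True by simp
    next
      case 2
      have "- mk2 a b c d \<in> word_mat_span"
        using word_mat_span_shift[OF one, of "- b"] 2 True by (simp add: mk2_uminus)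
      then show ?thesis by (simp only: word_mat_span_uminus)
    qed
  next
    case False
    define k where "k = a div c"
    have a: "a mod c = a - k * c" by (simp add: k_def minus_div_mult_eq_mod)
    have "\<bar>a mod c\<bar> < \<bar>c\<bar>" using False by (rule abs_mod_less)
    then have "mk2 (- c) (- d) (a mod c) (b - k * d) \<in> word_mat_span"
      using less(2) by (intro less(1)) (auto simp: a algebra_simps)
    then have "S_mat ** mk2 (- c) (- d) (a mod c) (b - k * d) \<in> word_mat_span"
      by (rule word_mat_span_mult)
    also have "S_mat ** mk2 (- c) (- d) (a mod c) (b - k * d) = - mk2 (a - k * c) (b - k * d) c d"
      by (simp add: mk2_mult mk2_uminus mk2_eq_iff a)
    finally have "mk2 (a - k * c) (b - k * d) c d \<in> word_mat_span"
      by (simp only: word_mat_span_uminus)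
    from word_mat_span_shift[OF this, of k] show ?thesis by simp
  qed
qed

text \<open>Up to sign, \<open>S U\<close> and \<open>S U\<^sup>2\<close> are the two elementary matrices with nonnegative entries.\<close>

lemma word_mat_syllables:
  defines "syl \<equiv> \<lambda>es. concat (map (\<lambda>e. True # replicate (if e then 2 else 1) False) es)"
  shows "\<exists>p q r s. (word_mat (syl es) = mk2 p q r s \<or> word_mat (syl es) = - mk2 p q r s) \<and>
    p \<ge> 1 \<and> s \<ge> 1 \<and> q \<ge> 0 \<and> r \<ge> 0 \<and> (es = [] \<or> p + q + r + s > 2)"
proof (induction es)
  case Nil
  show ?case by (rule exI[of _ 1], rule exI[of _ 0], rule exI[of _ 0], rule exI[of _ 1])
    (simp add: syl_def mk2_one)
next
  case (Cons e es)
  then obtain p q r s where IH: "word_mat (syl es) = mk2 p q r s \<or> word_mat (syl es) = - mk2 p q r s"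
    "p \<ge> 1" "s \<ge> 1" "q \<ge> 0" "r \<ge> 0" by blast
  show ?case
  proof (cases e)
    case True
    have "word_mat (syl (e # es)) = S_mat ** (U_mat ** (U_mat ** word_mat (syl es)))"
      using True by (simp add: syl_def numeral_2_eq_2)
    then have "word_mat (syl (e # es)) = mk2 p q (p + r) (q + s) \<or>
        word_mat (syl (e # es)) = - mk2 p q (p + r) (q + s)"
      using IH(1) by (auto simp: mk2_mult mk2_uminus mk2_eq_iff)
    then show ?thesis using IH(2-5)
      by (intro exI[of _ p] exI[of _ q] exI[of _ "p + r"] exI[of _ "q + s"]) auto
  next
    case False
    have "word_mat (syl (e # es)) = S_mat ** (U_mat ** word_mat (syl es))"
      using False by (simp add: syl_def)
    then have "word_mat (syl (e # es)) = mk2 (p + r) (q + s) r s \<or>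
        word_mat (syl (e # es)) = - mk2 (p + r) (q + s) r s"
      using IH(1) by (auto simp: mk2_mult mk2_uminus mk2_eq_iff)
    then show ?thesis using IH(2-5)
      by (intro exI[of _ "p + r"] exI[of _ "q + s"] exI[of _ r] exI[of _ s]) auto
  qed
qed

text \<open>The syllables multiply, up to sign, to a matrix with nonnegative entries and positive
  diagonal. Of the six choices for the outer powers of \<open>U\<close> and \<open>S\<close>, these
  signs leave only the trivial one. Then the entries sum to 2, which excludes any syllable.\<close>

lemma word_mat_nf_faithful:
  assumes a: "a < 3" and w: "word_mat (nf_word a es b) = mat 1 \<or> word_mat (nf_word a es b) = - mat 1"
  shows "nf_word a es b = []"
proof -
  define M where "M = word_mat (concat (map (\<lambda>e. True # replicate (if e then 2 else 1) False) es))"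
  obtain p q r s where M: "M = mk2 p q r s \<or> M = - mk2 p q r s"
    and pos: "p \<ge> 1" "s \<ge> 1" "q \<ge> 0" "r \<ge> 0" "es = [] \<or> p + q + r + s > 2"
    using word_mat_syllables[of es] unfolding M_def by blast
  have nf: "word_mat (nf_word a es b) =
      word_mat (replicate a False) ** (M ** word_mat (if b then [True] else []))"
    by (simp add: nf_word_def word_mat_append M_def)
  have "a \<in> {0, 1, 2}" using a by auto
  then have "a = 0 \<and> \<not> b \<and> p = 1 \<and> s = 1 \<and> q = 0 \<and> r = 0"
    using w M pos(1-4) unfolding nf
    by (cases b) (auto simp: mk2_mult mk2_uminus mk2_eq_iff mk2_one numeral_2_eq_2 matrix_mul_lid)
  then show ?thesis using pos(5) by (auto simp: nf_word_def)
qed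

interpretation PSL: free_product_2_3 PSL2Z "PSL_class S_mat" "PSL_class U_mat"
proof -
  interpret group PSL2Z by (rule group_PSL2Z)
  show "free_product_2_3 PSL2Z (PSL_class S_mat) (PSL_class U_mat)"
  proof
    show "PSL_class S_mat \<in> carrier PSL2Z" "PSL_class U_mat \<in> carrier PSL2Z"
      by (auto simp: PSL2Z_carrier mk2_det)
    show "PSL_class S_mat \<otimes>\<^bsub>PSL2Z\<^esub> PSL_class S_mat = \<one>\<^bsub>PSL2Z\<^esub>"
      by (simp add: PSL2Z_mult PSL2Z_one mk2_det mk2_mult PSL_class_eq_iff mk2_one mk2_uminus mk2_eq_iff)
    show "PSL_class U_mat \<otimes>\<^bsub>PSL2Z\<^esub> (PSL_class U_mat \<otimes>\<^bsub>PSL2Z\<^esub> PSL_class U_mat) = \<one>\<^bsub>PSL2Z\<^esub>"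
      by (simp add: PSL2Z_mult PSL2Z_one mk2_det mk2_mult PSL_class_eq_iff mk2_one mk2_uminus mk2_eq_iff)
  next
    fix g assume "g \<in> carrier PSL2Z"
    then obtain A where A: "g = PSL_class A" "det A = 1" by (auto simp: PSL2Z_carrier)
    obtain a b c d where "A = mk2 a b c d" using mk2_exists by blast
    then have "A \<in> word_mat_span" using A(2) word_mat_span_det_1 by (simp add: mk2_det)
    then show "\<exists>w. word_eval PSL2Z (PSL_class S_mat) (PSL_class U_mat) w = g"
      by (auto simp: word_mat_span_def word_eval_PSL2Z A(1) PSL_class_eq_iff)
  next
    fix a es b
    assume "a < 3" "word_eval PSL2Z (PSL_class S_mat) (PSL_class U_mat) (nf_word a es b) = \<one>\<^bsub>PSL2Z\<^esub>"
    then show "nf_word a es b = []"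
      by (intro word_mat_nf_faithful) (auto simp: word_eval_PSL2Z PSL2Z_one PSL_class_eq_iff)
  qed
qed

lemma num_free_subgroups_eq: "num_free_subgroups l = card (PSL.free_index (6 * l))"
  by (simp add: num_free_subgroups_def PSL.free_index_def)

section \<open>Bessel polynomials and the Riccati equation\<close>

hide_const (open) UnivPoly.coeff UnivPoly.monom

text \<open>Equal to \<open>(-6)^l (N + l)! / ((N - l)! l!)\<close> for \<open>l \<le> N\<close>,
  the coefficients of the Bessel polynomial \<open>y_N\<close> at \<open>-12 z\<close>. The binomial
  form is integral and vanishes by itself for \<open>l > N\<close>.\<close>

definition bessel_coeff :: "nat \<Rightarrow> nat \<Rightarrow> int" where
  "bessel_coeff N l =
     (-6) ^ l * int ((N + l) choose (2 * l)) * int ((2 * l) choose l) * fact l"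

lemma bessel_coeff_rec:
  "int (Suc l) * bessel_coeff N (Suc l) =
     6 * (int l - int N) * (int l + int N + 1) * bessel_coeff N l"
proof (cases "l < N")
  case True
  have fact_form: "real_of_int (bessel_coeff N k) = (-6) ^ k * fact (N + k) / (fact (N - k) * fact k)"
    if "k \<le> N" for k
  proof -
    have "2 * k \<le> N + k" "N + k - 2 * k = N - k" using that by auto
    then show ?thesis
      using binomial_fact[of "2 * k" "N + k", where 'a = real]
        binomial_fact[of k "2 * k", where 'a = real]
      by (simp add: bessel_coeff_def mult_2)
  qed
  have "N - l = Suc (N - Suc l)" using True by simp
  then have f: "fact (N - l) = (real N - real l) * fact (N - Suc l)"
    using True by (simp add: of_nat_diff)
  have g: "real (Suc l) * (- 6 * p * ((real N + real l + 1) * x) / (g * (real (Suc l) * h))) =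
      6 * (real l - real N) * (real l + real N + 1) * (p * x / ((real N - real l) * g * h))"
    if "g \<noteq> 0" "h \<noteq> 0" for p x g h :: real
    using True that by (simp add: divide_simps del: of_nat_Suc) (simp add: algebra_simps)
  have "real_of_int (int (Suc l) * bessel_coeff N (Suc l)) =
     real_of_int (6 * (int l - int N) * (int l + int N + 1) * bessel_coeff N l)"
    using True fact_form[of l] fact_form[of "Suc l"]
      g[of "fact (N - Suc l)" "fact l" "(-6) ^ l" "fact (N + l)"]
    by (simp add: f add_ac)
  then show ?thesis by (simp only: of_int_eq_iff)
next
  case False
  then show ?thesis
    by (cases "l = N") (auto simp: bessel_coeff_def binomial_eq_0)
qed

definition bessel_poly :: "nat \<Rightarrow> int poly" where
  "bessel_poly N = (\<Sum>l\<le>N. monom (bessel_coeff N l) l)"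

lemma coeff_bessel_poly: "coeff (bessel_poly N) l = bessel_coeff N l"
proof (cases "l \<le> N")
  case True
  then show ?thesis
    by (simp add: bessel_poly_def coeff_sum)
next
  case False
  then show ?thesis
    by (simp add: bessel_poly_def coeff_sum bessel_coeff_def binomial_eq_0)
qed

lemma bessel_poly_ode:
  defines "Y \<equiv> \<lambda>N. fps_of_poly (bessel_poly N)"
  shows "fps_XD (Y N) =
    6 * fps_X * (fps_XD (fps_XD (Y N)) + fps_XD (Y N) - fps_const (int N * (int N + 1)) * Y N)"
proof (rule fps_ext)
  fix n
  show "fps_nth (fps_XD (Y N)) n = fps_nth (6 * fps_X *
      (fps_XD (fps_XD (Y N)) + fps_XD (Y N) - fps_const (int N * (int N + 1)) * Y N)) n"
    using bessel_coeff_rec[of "n - 1" N]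
    by (cases n)
      (simp_all add: Y_def coeff_bessel_poly fps_XD_nth numeral_fps_const mult.assoc algebra_simps)
qed

lemma fps_XD_mult: "fps_XD (A * B) = fps_XD A * B + A * fps_XD (B :: 'a :: comm_ring_1 fps)"
  by (simp add: fps_XD_def algebra_simps)

text \<open>For \<open>36 k = -5\<close> the equation of \<open>Y\<close> would be the exact
  linearization and \<open>V\<close> would be \<open>6 z Y' / Y\<close>. In general the defect
  \<open>W\<close> satisfies a linear equation whose inhomogeneous term is a multiple of
  \<open>5 + 36 k\<close>. Each coefficient of \<open>W\<close> is an integral combination of
  earlier ones and this term, so divisibility by \<open>m\<close> propagates without any
  division.\<close>

lemma riccati_linearization_dvd:
  fixes V Y :: "int fps"
  assumes V: "V = fps_X * (6 * fps_XD V + V\<^sup>2 + 6 * V + 5)"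
    and Y: "fps_XD Y = 6 * fps_X * (fps_XD (fps_XD Y) + fps_XD Y - fps_const k * Y)"
    and m: "m dvd 5 + 36 * k"
  shows "m dvd fps_nth (V * Y - 6 * fps_XD Y) n"
proof -
  define W where "W = V * Y - 6 * fps_XD Y"
  have VY: "V * Y = W + 6 * fps_XD Y" by (simp add: W_def)
  have D: "fps_XD V * Y = fps_XD W + 6 * fps_XD (fps_XD Y) - V * fps_XD Y"
    using fps_XD_mult[of V Y] fps_XD_mult[of 6 "fps_XD Y"]
    by (simp add: W_def fps_XD_def algebra_simps)
  have "V * Y = fps_X * (6 * (fps_XD V * Y) + V * (V * Y) + 6 * (V * Y) + 5 * Y)"
    by (subst (1) V) (simp add: algebra_simps power2_eq_square)
  also have "\<dots> = fps_X * (6 * fps_XD W + V * W + 6 * W + fps_const (5 + 36 * k) * Y) +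
      6 * (6 * fps_X * (fps_XD (fps_XD Y) + fps_XD Y - fps_const k * Y))"
    unfolding D VY
    by (simp add: algebra_simps fps_const_add[symmetric] fps_const_mult[symmetric]
        numeral_fps_const[symmetric] del: fps_const_add fps_const_mult)
  finally have "V * Y = fps_X * (6 * fps_XD W + V * W + 6 * W + fps_const (5 + 36 * k) * Y) +
      6 * fps_XD Y"
    by (subst Y)
  then have W: "W = fps_X * (6 * fps_XD W + V * W + 6 * W + fps_const (5 + 36 * k) * Y)"
    unfolding VY by (rule add_right_imp_eq)
  have "m dvd fps_nth W n"
  proof (induction n rule: less_induct)
    case (less n)
    show ?case
    proof (cases n)
      case 0
      then show ?thesis by (subst W) simp
    next
      case (Suc i)
      have "fps_nth W n = 6 * (int i * fps_nth W i) + (\<Sum>j=0..i. fps_nth V j * fps_nth W (i - j))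
          + 6 * fps_nth W i + (5 + 36 * k) * fps_nth Y i"
        by (subst W) (simp add: Suc fps_XD_nth numeral_fps_const mult.assoc flip: fps_mult_nth)
      moreover have "m dvd (\<Sum>j=0..i. fps_nth V j * fps_nth W (i - j))"
        by (intro dvd_sum dvd_mult less) (auto simp: Suc)
      ultimately show ?thesis
        using less[of i] m Suc by (auto intro!: dvd_add)
    qed
  qed
  then show ?thesis by (simp add: W_def)
qed

section \<open>Power series modulo an integer\<close>

lemma fps_const_dvd_iff:
  "fps_const m dvd A \<longleftrightarrow> (\<forall>n. (m :: int) dvd fps_nth A n)"
proof
  assume "\<forall>n. m dvd fps_nth A n"
  then obtain f where "\<forall>n. fps_nth A n = m * f n" unfolding dvd_def by metis
  then have "A = fps_const m * Abs_fps f" by (auto simp: fps_eq_iff)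
  then show "fps_const m dvd A" by simp
qed (auto simp: dvd_def)

lemma fps_const_dvd_fps_of_poly:
  "fps_const (m :: int) dvd fps_of_poly p \<longleftrightarrow> [:m:] dvd p"
  by (simp add: fps_const_dvd_iff const_poly_dvd_iff)

lemma fps_coeffs_cong_iff_dvd: "fps_coeffs_cong A B m \<longleftrightarrow> fps_const m dvd A - B"
  by (simp add: fps_coeffs_cong_def fps_const_dvd_iff cong_iff_dvd_diff)

lemma fps_const_dvd_eventually_polynomial:
  fixes A :: "int fps"
  shows "(\<exists>R. fps_const m dvd A - fps_of_poly R) \<longleftrightarrow> (\<exists>n0. \<forall>n\<ge>n0. m dvd fps_nth A n)"
proof
  assume "\<exists>R. fps_const m dvd A - fps_of_poly R"
  then obtain R where R: "\<And>n. m dvd fps_nth A n - coeff R n"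
    by (auto simp: fps_const_dvd_iff)
  show "\<exists>n0. \<forall>n\<ge>n0. m dvd fps_nth A n"
  proof (intro exI allI impI)
    fix n assume "Suc (degree R) \<le> n"
    then show "m dvd fps_nth A n" using R[of n] by (simp add: coeff_eq_0)
  qed
next
  assume "\<exists>n0. \<forall>n\<ge>n0. m dvd fps_nth A n"
  then obtain n0 where n0: "\<forall>n\<ge>n0. m dvd fps_nth A n" by blast
  have "coeff (\<Sum>i<n0. monom (fps_nth A i) i) n = (if n < n0 then fps_nth A n else 0)" for n
    by (simp add: coeff_sum)
  then show "\<exists>R. fps_const m dvd A - fps_of_poly R"
    using n0 by (intro exI[of _ "\<Sum>i<n0. monom (fps_nth A i) i"]) (auto simp: fps_const_dvd_iff)
qed

lemma poly_dvd_of_const_dvd: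
  fixes p :: "int poly"
  assumes "[:m:] dvd p"
  shows "m dvd poly p x"
  using assms by (auto simp: dvd_def)

lemma diff_dvd_poly_diff: "(a - b :: int) dvd poly p a - poly p b"
proof -
  have "[:- b, 1:] dvd p - [:poly p b:]" by (simp add: poly_eq_0_iff_dvd[symmetric])
  then obtain q where q: "p - [:poly p b:] = [:- b, 1:] * q" by (auto simp: dvd_def)
  have "poly p a - poly p b = poly (p - [:poly p b:]) a" by simp
  then have "poly p a - poly p b = (a - b) * poly q a" unfolding q by (simp add: algebra_simps)
  then show ?thesis by simp
qed

text \<open>On the zeros of \<open>Y\<close> the power \<open>x ^ 6\<close> is \<open>1\<close> modulo \<open>7\<close>, and raising to
  the seventh power improves the precision by one factor \<open>7\<close>.\<close>

lemma X_power_minus_1_decomp: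
  fixes Y K :: "int poly"
  assumes Y: "Y = [:1, 2:] + [:7:] * K"
  shows "\<exists>A B. [:0, 1:] ^ (6 * 7 ^ k) - 1 = Y * A + [:7 ^ Suc k:] * B"
proof (induction k)
  case 0
  \<comment> \<open>The geometric sum for \<open>64 z^6 - 1 = (2 z)^6 - 1\<close> has the factor
    \<open>1 + 2 z\<close>, and \<open>64 = 1 + 63\<close>.\<close>
  have "([:0, 1:] :: int poly) ^ 6 - 1 = [:1, 2:] * [:-1, 2, -4, 8, -16, 32:] - [:63:] * [:0, 1:] ^ 6" (is "_ = _ * ?T - _")
    by (simp add: eval_nat_numeral one_pCons)
  also have "\<dots> = Y * ?T + [:7:] * (- K * ?T - [:9:] * [:0, 1:] ^ 6)"
    unfolding Y by (simp add: algebra_simps del: mult_pCons_left mult_pCons_right) (simp add: eval_nat_numeral)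
  finally show ?case by (intro exI) (simp only: power_0 mult_1_right power_Suc)
next
  case (Suc k)
  then obtain A B where AB: "[:0, 1:] ^ (6 * 7 ^ k) - 1 = Y * A + [:7 ^ Suc k:] * B" by blast
  define c where "c = [:7 ^ Suc k:] * B"
  define t :: "int poly" where "t = [:0, 1:] ^ (6 * 7 ^ k)"
  have t: "t = Y * A + (1 + c)" using AB by (simp add: c_def t_def algebra_simps)
  have "t - (1 + c) dvd t ^ 7 - (1 + c) ^ 7"
    using power_diff_sumr2[of t 7 "1 + c"] by simp
  then have "Y dvd t ^ 7 - (1 + c) ^ 7" by (metis add_diff_cancel_right' dvd_mult_left t)
  moreover have "[:7 ^ Suc (Suc k):] dvd (1 + c) ^ 7 - 1"
  proof -
    \<comment> \<open>The binomial coefficients 7, 21, 35, 35, 21, 7 are multiples of 7. The factor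
      \<open>c\<close> supplies the old precision, the bracket one more 7.\<close>
    have "(1 + c) ^ 7 - 1 = c * ([:7:] * (1 + 3 * c + 5 * c ^ 2 + 5 * c ^ 3 + 3 * c ^ 4 + c ^ 5) + c ^ 6)"
      by (simp add: eval_nat_numeral algebra_simps flip: numeral_poly)
    moreover have "[:7 ^ Suc k:] dvd c" unfolding c_def by (rule dvd_triv_left)
    moreover have "[:7:] dvd c" by (auto simp: c_def const_poly_dvd_iff)
    then have "[:7:] dvd [:7:] * (1 + 3 * c + 5 * c ^ 2 + 5 * c ^ 3 + 3 * c ^ 4 + c ^ 5) + c ^ 6"
      using dvd_trans[OF _ dvd_power[of 6 c]] by (intro dvd_add dvd_triv_left) auto
    ultimately have "[:7 ^ Suc k:] * [:7:] dvd (1 + c) ^ 7 - 1"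
      by (metis mult_dvd_mono)
    then show ?thesis by (simp add: mult.commute)
  qed
  moreover have "[:0, 1:] ^ (6 * 7 ^ Suc k) = t ^ 7"
    by (simp add: t_def flip: power_mult)
  ultimately obtain A' B' where "t ^ 7 - (1 + c) ^ 7 = Y * A'" "(1 + c) ^ 7 - 1 = [:7 ^ Suc (Suc k):] * B'"
    by (auto simp: dvd_def)
  then have "t ^ 7 - 1 = Y * A' + [:7 ^ Suc (Suc k):] * B'"
    by (metis (no_types, lifting) add.commute diff_add_cancel diff_add_eq)
  then show ?case using \<open>[:0, 1:] ^ (6 * 7 ^ Suc k) = t ^ 7\<close> by metis
qed

section \<open>The Bessel polynomial modulo 7\<close>

lemma bessel_coeff_0: "bessel_coeff N 0 = 1"
  by (simp add: bessel_coeff_def)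

text \<open>The factor \<open>l - N\<close> of the recurrence vanishes modulo 7 at
  \<open>l = 1\<close>, which kills the coefficient at 2. The recurrence passes this on while
  \<open>l + 1\<close> is invertible modulo 7; from 7 on the factorial takes over.\<close>

lemma dvd_bessel_coeff:
  assumes N: "[N = 1] (mod 7)" and l: "l \<ge> 2"
  shows "7 dvd bessel_coeff N l"
proof (cases "l < 7")
  case True
  have "l < 7 \<longrightarrow> 7 dvd bessel_coeff N l"
    using l
  proof (induction l rule: dec_induct)
    case base
    have "7 dvd 1 - int N"
      using N by (simp add: cong_iff_dvd_diff[symmetric] cong_sym_eq flip: cong_int_iff)
    then have "7 dvd 6 * (1 - int N) * (1 + int N + 1) * bessel_coeff N 1"
      by (intro dvd_mult2 dvd_mult)
    then have "7 dvd 2 * bessel_coeff N 2"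
      using bessel_coeff_rec[of 1 N] by (simp add: numeral_2_eq_2)
    then show ?case by (simp add: prime_dvd_mult_iff)
  next
    case (step l)
    show ?case
    proof
      assume "Suc l < 7"
      then have "7 dvd bessel_coeff N l" using step by simp
      then have "7 dvd int (Suc l) * bessel_coeff N (Suc l)"
        by (simp only: bessel_coeff_rec dvd_mult)
      moreover have "\<not> 7 dvd int (Suc l)"
        using \<open>Suc l < 7\<close> by (auto dest!: zdvd_imp_le)
      ultimately show "7 dvd bessel_coeff N (Suc l)"
        by (simp add: prime_dvd_mult_iff del: of_nat_Suc)
    qed
  qed
  then show ?thesis using True by simp
next
  case False
  then have "(7 :: int) dvd fact l" using dvd_fact[of 7 l] by (metis int_dvd_int_iff of_nat_fact of_nat_numeral one_le_numeral not_less)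
  then show ?thesis by (simp add: bessel_coeff_def)
qed

text \<open>The linear coefficient is \<open>-6 N (N + 1)\<close>, congruent to -12 and thus to 2:
  the origin of \<open>1 + 2 z\<close>.\<close>

lemma bessel_poly_mod_7:
  assumes N: "[N = 1] (mod 7)"
  shows "\<exists>K. bessel_poly N = [:1, 2:] + [:7:] * K"
proof -
  have "[:7:] dvd bessel_poly N - [:1, 2:]"
    unfolding const_poly_dvd_iff
  proof
    fix n
    have "[int N = 1] (mod 7)" using N by (metis cong_int_iff of_nat_1 of_nat_numeral)
    then have "[- (int N * (int N + 1) * 6) = - (1 * (1 + 1) * 6)] (mod 7)"
      by (intro cong_minus_minus_iff[THEN iffD2] cong_mult cong_add) auto
    then have "[- (int N * (int N + 1) * 6) = 2] (mod 7)" by (simp add: cong_def)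
    moreover have "bessel_coeff N 1 = - (int N * (int N + 1) * 6)"
      using bessel_coeff_rec[of 0 N] by (simp add: bessel_coeff_0)
    ultimately have "7 dvd bessel_coeff N 1 - 2" by (simp add: cong_iff_dvd_diff)
    then show "7 dvd coeff (bessel_poly N - [:1, 2:]) n"
      using dvd_bessel_coeff[OF N, of n]
      by (cases "n < 2")
        (auto simp: coeff_bessel_poly coeff_pCons less_2_cases_iff bessel_coeff_0 split: nat.splits)
  qed
  then obtain K where "bessel_poly N - [:1, 2:] = [:7:] * K" by (auto simp: dvd_def)
  then have "bessel_poly N = [:1, 2:] + [:7:] * K" by (simp add: algebra_simps)
  then show ?thesis ..
qed

section \<open>The Riccati equation modulo powers of seven\<close>

lemma residue_primroot_7_3: "residue_primroot 7 3"
  by code_simp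

text \<open>The numerator of \<open>1 + 6 z Y' / Y\<close>, which represents \<open>F\<close> modulo
  a suitable power of 7.\<close>

definition bessel_num :: "nat \<Rightarrow> int poly" where
  "bessel_num N = bessel_poly N + 6 * [:0, 1:] * pderiv (bessel_poly N)"

definition mod7_index :: "nat \<Rightarrow> nat" where
  "mod7_index a = (\<Sum>i<a. 7 ^ i)"

lemma mod7_index: "6 * int (mod7_index a) + 1 = 7 ^ a"
  by (induction a) (simp_all add: mod7_index_def)

lemma mod7_index_cong: "a \<ge> 1 \<Longrightarrow> [mod7_index a = 1] (mod 7)"
proof (induction a rule: dec_induct)
  case (step n)
  then have "[mod7_index n + 7 ^ n = 1 + 0] (mod 7)"
    by (intro cong_add) (auto simp: cong_0_iff)
  then show ?case by (simp add: mod7_index_def)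
qed (simp add: mod7_index_def)

text \<open>Multiplication by \<open>fps_X ^ q - 1\<close> takes differences at distance
  \<open>q\<close>, so an eventual period \<open>q\<close> means that a polynomial remains. In this
  form it can be compared with the denominator \<open>Y\<close>.\<close>

definition mod_period :: "int fps \<Rightarrow> nat \<Rightarrow> nat \<Rightarrow> bool" where
  "mod_period V a q \<longleftrightarrow> (\<exists>R. fps_const (7 ^ a) dvd (1 + V) * (fps_X ^ q - 1) - fps_of_poly R)"

text \<open>In place of Hensel lifting: \<open>Y(x) - Y(y)\<close> is \<open>x - y\<close> times a
  unit modulo 7, so evaluation is injective on the finite set of residues, hence surjective, and
  takes the value 0.\<close>

lemma bessel_poly_root:
  assumes "a \<ge> 1"
  shows "\<exists>r::nat. 7 ^ a dvd poly (bessel_poly (mod7_index a)) (int r)"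
proof -
  define Y where "Y = bessel_poly (mod7_index a)"
  obtain K where K: "Y = [:1, 2:] + [:7:] * K"
    using bessel_poly_mod_7 mod7_index_cong[OF assms] unfolding Y_def by blast
  define f where "f = (\<lambda>x. poly Y x mod 7 ^ a)"
  have "inj_on f {0..<7 ^ a}"
  proof (rule inj_onI)
    fix x y :: int assume xy: "x \<in> {0..<7 ^ a}" "y \<in> {0..<7 ^ a}" "f x = f y"
    obtain e where e: "poly K x - poly K y = (x - y) * e"
      using diff_dvd_poly_diff[of x y K] by (auto simp: dvd_def)
    have "7 ^ a dvd poly Y x - poly Y y" using xy(3) by (simp add: f_def mod_eq_dvd_iff)
    also have "poly Y x - poly Y y = 2 * (x - y) + 7 * (poly K x - poly K y)"
      by (simp add: K algebra_simps)
    also have "\<dots> = (x - y) * (2 + 7 * e)" unfolding e by (simp add: algebra_simps)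
    finally have "7 ^ a dvd (x - y) * (2 + 7 * e)" .
    moreover have "\<not> 7 dvd 2 + 7 * e" by presburger
    then have "coprime (7 ^ a) (2 + 7 * e)"
      by (intro coprime_power_left_iff[THEN iffD2] disjI1 prime_imp_coprime) auto
    ultimately have "7 ^ a dvd x - y" by (simp add: coprime_dvd_mult_left_iff)
    then have "x mod 7 ^ a = y mod 7 ^ a" by (simp add: mod_eq_dvd_iff)
    then show "x = y" using xy(1,2) by simp
  qed
  moreover have "f ` {0..<7 ^ a} \<subseteq> {0..<7 ^ a}" by (auto simp: f_def)
  ultimately have "f ` {0..<7 ^ a} = {0..<7 ^ a}" by (intro endo_inj_surj) auto
  then have "0 \<in> f ` {0..<7 ^ a}" by simp
  then obtain x where "x \<in> {0..<7 ^ a}" "f x = 0" by force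
  then have "7 ^ a dvd poly Y (int (nat x))" by (auto simp: f_def mod_eq_0_iff_dvd)
  then show ?thesis unfolding Y_def by blast
qed

text \<open>Modulo 7 the denominator is \<open>1 + 2 z\<close>, with root 3, while the numerator
  becomes \<open>1 + 14 z\<close>, that is, 1. They share no root, so the root of \<open>Y\<close>
  really constrains the periods.\<close>

lemma bessel_num_root_not_dvd:
  assumes "a \<ge> 1" "7 dvd poly (bessel_poly (mod7_index a)) x"
  shows "[x = 3] (mod 7)" "\<not> 7 dvd poly (bessel_num (mod7_index a)) x"
proof -
  obtain K where K: "bessel_poly (mod7_index a) = [:1, 2:] + [:7:] * K"
    using bessel_poly_mod_7 mod7_index_cong[OF assms(1)] by blast
  have "7 dvd 1 + 2 * x + 7 * poly K x" using assms(2) by (simp add: K algebra_simps)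
  then have "7 dvd 1 + 2 * x" by presburger
  then show x: "[x = 3] (mod 7)" unfolding cong_def by presburger
  have "poly (bessel_num (mod7_index a)) x = (1 + 2 * x) + 7 * poly K x + 12 * x + 7 * (6 * x * poly (pderiv K) x)"
    unfolding bessel_num_def K
    by (simp add: pderiv_add pderiv_smult pderiv_pCons algebra_simps)
  then show "\<not> 7 dvd poly (bessel_num (mod7_index a)) x"
    using x unfolding cong_def by presburger
qed

lemma prime_power_dvd_mult_cancel:
  fixes p x y :: int
  assumes "prime p" "p ^ a dvd x * y" "\<not> p dvd y"
  shows "p ^ a dvd x"
proof -
  have "coprime (p ^ a) y"
    using assms(1,3) by (intro coprime_power_left_iff[THEN iffD2] disjI1 prime_imp_coprime) auto
  then show ?thesis using assms(2) by (simp add: coprime_dvd_mult_left_iff)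
qed

text \<open>The case \<open>8 = (7^2 - 1) / 6\<close>, belonging to the modulus 49.\<close>

lemma poly_bessel_8: "poly (bessel_poly 8) x = 1 + (-432) * x ^ 1 + (90720) * x ^ 2 + (-11975040) * x ^ 3 + (1077753600) * x ^ 4 + (-67251824640) * x ^ 5 + (2824576634880) * x ^ 6 + (-72631970611200) * x ^ 7 + (871583647334400) * x ^ 8"
proof -
  have c: "bessel_coeff 8 0 = 1" by (rule bessel_coeff_0)
  have c1: "bessel_coeff 8 1 = -432" using bessel_coeff_rec[of 0 8] c by simp
  have c2: "bessel_coeff 8 2 = 90720" using bessel_coeff_rec[of 1 8] c1 by (simp add: numeral_2_eq_2)
  have c3: "bessel_coeff 8 3 = -11975040" using bessel_coeff_rec[of 2 8] c2 by simp
  have c4: "bessel_coeff 8 4 = 1077753600" using bessel_coeff_rec[of 3 8] c3 by simp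
  have c5: "bessel_coeff 8 5 = -67251824640" using bessel_coeff_rec[of 4 8] c4 by simp
  have c6: "bessel_coeff 8 6 = 2824576634880" using bessel_coeff_rec[of 5 8] c5 by simp
  have c7: "bessel_coeff 8 7 = -72631970611200" using bessel_coeff_rec[of 6 8] c6 by simp
  have c8: "bessel_coeff 8 8 = 871583647334400" using bessel_coeff_rec[of 7 8] c7 by simp
  have "{..8::nat} = {0, 1, 2, 3, 4, 5, 6, 7, 8}" by auto
  then show ?thesis
    by (simp add: bessel_poly_def poly_sum poly_monom c c1[unfolded One_nat_def] c2 c3 c4 c5 c6 c7 c8)
qed

section \<open>Rationality and periods derived from the Riccati equation\<close>

context
  fixes V :: "int fps"
  assumes riccati: "V = fps_X * (6 * fps_XD V + V\<^sup>2 + 6 * V + 5)"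
begin

text \<open>The ODE of the Bessel polynomial is a perturbation of the linearized Riccati equation
  whenever \<open>6 * N = - 1\<close> modulo \<open>m\<close>, because \<open>5 + 36 * N * (N + 1) = (6 * N + 1) * (6 * N + 5)\<close>.\<close>

lemma riccati_times_bessel:
  assumes "m dvd 6 * int N + 1"
  shows "fps_const m dvd (1 + V) * fps_of_poly (bessel_poly N) - fps_of_poly (bessel_num N)"
proof -
  have "5 + 36 * (int N * (int N + 1)) = (6 * int N + 1) * (6 * int N + 5)"
    by (simp add: algebra_simps)
  then have "m dvd 5 + 36 * (int N * (int N + 1))" using assms by simp
  then have "fps_const m dvd V * fps_of_poly (bessel_poly N) - 6 * fps_XD (fps_of_poly (bessel_poly N))"
    unfolding fps_const_dvd_iff using riccati_linearization_dvd[OF riccati bessel_poly_ode] by blast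
  moreover have "fps_of_poly (bessel_num N) = fps_of_poly (bessel_poly N) + 6 * fps_XD (fps_of_poly (bessel_poly N))"
    by (simp add: bessel_num_def fps_of_poly_add fps_of_poly_mult fps_of_poly_pderiv fps_XD_def mult.assoc fps_of_poly_pCons)
  ultimately show ?thesis by (simp add: algebra_simps)
qed

text \<open>Since \<open>Y = (1 + 2 z) + 7 K\<close>, it divides
  \<open>(1 + 2 z)^a - (- 7 K)^a\<close>, and the second power vanishes modulo \<open>7^a\<close>.
  The cofactor expands the denominator \<open>Y\<close> to \<open>(1 + 2 z)^a\<close>.\<close>

lemma riccati_rational_mod_power_7:
  assumes "a \<ge> 1"
  shows "\<exists>P. fps_coeffs_cong (1 + V) (fps_quot (fps_of_poly P) ((1 + 2 * fps_X) ^ a)) (7 ^ a)"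
proof -
  define N where "N = mod7_index a"
  obtain K where K: "bessel_poly N = [:1, 2:] + [:7:] * K"
    using bessel_poly_mod_7 mod7_index_cong[OF assms] unfolding N_def by blast
  have e: "[:1, 2:] ^ a - (- ([:7:] * K)) ^ a = bessel_poly N * (\<Sum>i<a. (- ([:7:] * K)) ^ (a - Suc i) * [:1, 2:] ^ i)"
    (is "_ = _ * ?S")
    unfolding K using power_diff_sumr2[of "[:1, 2:]" a "- ([:7:] * K)"] by simp
  have "[:7 ^ a:] dvd (- ([:7:] * K)) ^ a"
  proof -
    have "(- ([:7:] * K)) ^ a = [:7 ^ a:] * (- K) ^ a"
      by (simp only: mult_minus_right[symmetric] power_mult_distrib poly_const_pow)
    then show ?thesis by (metis dvd_triv_left)
  qed
  then obtain B where "(- ([:7:] * K)) ^ a = [:7 ^ a:] * B" by (elim dvdE)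
  with e have B: "[:1, 2:] ^ a = bessel_poly N * ?S + [:7 ^ a:] * B" by (simp only: diff_eq_eq)
  let ?w = "(1 + 2 * fps_X :: int fps) ^ a"
  have w: "?w = fps_of_poly (bessel_poly N) * fps_of_poly ?S + fps_const (7 ^ a) * fps_of_poly B"
  proof -
    have "?w = fps_of_poly ([:1, 2:] ^ a)"
      by (simp add: fps_of_poly_power fps_of_poly_pCons numeral_fps_const)
    then show ?thesis unfolding B
      by (simp only: fps_of_poly_add fps_of_poly_mult fps_of_poly_const)
  qed
  have "fps_const (7 ^ a) dvd ((1 + V) * fps_of_poly (bessel_poly N) - fps_of_poly (bessel_num N)) * fps_of_poly ?S
      + fps_const (7 ^ a) * (fps_of_poly B * (1 + V))"
    using riccati_times_bessel[of "7 ^ a" N] by (simp add: N_def mod7_index)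
  also have "\<dots> = (1 + V) * ?w - fps_of_poly (bessel_num N * ?S)"
    unfolding w by (simp add: algebra_simps fps_of_poly_mult)
  finally have dvd: "fps_const (7 ^ a) dvd (1 + V) * ?w - fps_of_poly (bessel_num N * ?S)" .
  have inv: "?w * fps_right_inverse ?w 1 = 1"
    by (rule fps_right_inverse) (simp add: fps_nth_power_0)
  have eq: "(1 + V) - fps_quot (fps_of_poly (bessel_num N * ?S)) ?w =
      ((1 + V) * ?w - fps_of_poly (bessel_num N * ?S)) * fps_right_inverse ?w 1"
    unfolding fps_quot_def left_diff_distrib mult.assoc inv by simp
  have "fps_coeffs_cong (1 + V) (fps_quot (fps_of_poly (bessel_num N * ?S)) ?w) (7 ^ a)"
    unfolding fps_coeffs_cong_iff_dvd eq using dvd by (rule dvd_mult2)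
  then show ?thesis by (rule exI)
qed

lemma mod_period_6_7:
  assumes "a \<ge> 1"
  shows "mod_period V a (6 * 7 ^ (a - 1))"
proof -
  define N where "N = mod7_index a"
  obtain K where K: "bessel_poly N = [:1, 2:] + [:7:] * K"
    using bessel_poly_mod_7 mod7_index_cong[OF assms] unfolding N_def by blast
  obtain A B where AB: "[:0, 1:] ^ (6 * 7 ^ (a - 1)) - 1 = bessel_poly N * A + [:7 ^ a:] * B"
    using X_power_minus_1_decomp[OF K, of "a - 1"] assms by auto
  have "fps_X ^ (6 * 7 ^ (a - 1)) - 1 = fps_of_poly ([:0, 1:] ^ (6 * 7 ^ (a - 1)) - 1 :: int poly)"
    by (simp add: fps_of_poly_diff fps_of_poly_power fps_of_poly_pCons)
  then have X: "fps_X ^ (6 * 7 ^ (a - 1)) - 1 =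
      fps_of_poly (bessel_poly N) * fps_of_poly A + fps_const (7 ^ a) * fps_of_poly B"
    unfolding AB by (simp only: fps_of_poly_add fps_of_poly_mult fps_of_poly_const)
  have "fps_const (7 ^ a) dvd ((1 + V) * fps_of_poly (bessel_poly N) - fps_of_poly (bessel_num N)) * fps_of_poly A
      + fps_const (7 ^ a) * (fps_of_poly B * (1 + V))"
    using riccati_times_bessel[of "7 ^ a" N] by (simp add: N_def mod7_index)
  also have "\<dots> = (1 + V) * (fps_X ^ (6 * 7 ^ (a - 1)) - 1) - fps_of_poly (bessel_num N * A)"
    unfolding X by (simp add: algebra_simps fps_of_poly_mult)
  finally show ?thesis unfolding mod_period_def by blast
qed

text \<open>The power series \<open>V\<close> cannot be evaluated at \<open>r\<close>.
  Cross-multiplying its two representations eliminates it and leaves the polynomial congruence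
  \<open>P (z^q - 1) = R Y\<close>. At the root of \<open>Y\<close> the factor \<open>P\<close> is a
  unit.\<close>

lemma mod_period_imp_root_power:
  assumes a: "a \<ge> 1" and r: "7 ^ a dvd poly (bessel_poly (mod7_index a)) (int r)" and q: "mod_period V a q"
  shows "[r ^ q = 1] (mod 7 ^ a)"
proof -
  let ?Y = "bessel_poly (mod7_index a)" and ?P = "bessel_num (mod7_index a)"
  obtain R where R: "fps_const (7 ^ a) dvd (1 + V) * (fps_X ^ q - 1) - fps_of_poly R"
    using q by (auto simp: mod_period_def)
  have "fps_const (7 ^ a) dvd ((1 + V) * (fps_X ^ q - 1) - fps_of_poly R) * fps_of_poly ?Y
      - ((1 + V) * fps_of_poly ?Y - fps_of_poly ?P) * (fps_X ^ q - 1)"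
    using R riccati_times_bessel[of "7 ^ a" "mod7_index a"]
    by (intro dvd_diff[OF dvd_mult2 dvd_mult2]) (simp_all add: mod7_index)
  also have "\<dots> = fps_of_poly (?P * ([:0, 1:] ^ q - 1) - R * ?Y)"
    by (simp add: fps_of_poly_diff fps_of_poly_mult fps_of_poly_power fps_of_poly_pCons algebra_simps)
  finally have "7 ^ a dvd poly (?P * ([:0, 1:] ^ q - 1) - R * ?Y) (int r)"
    by (intro poly_dvd_of_const_dvd) (simp only: fps_const_dvd_fps_of_poly)
  then have prod: "7 ^ a dvd (int r ^ q - 1) * poly ?P (int r)"
    using r by (simp add: mult.commute dvd_diff_left_iff dvd_diff_right_iff)
  have "7 dvd poly ?Y (int r)" using dvd_trans[OF dvd_power[of a "7 :: int"] r] a by simp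
  then have unit: "\<not> 7 dvd poly ?P (int r)" by (rule bessel_num_root_not_dvd(2)[OF a])
  have "7 ^ a dvd int r ^ q - 1"
    by (rule prime_power_dvd_mult_cancel[OF _ prod unit]) simp
  then have "[int (r ^ q) = int 1] (mod int (7 ^ a))" by (simp add: cong_iff_dvd_diff)
  then show ?thesis by (simp only: cong_int_iff)
qed

text \<open>Modulo 49 the series \<open>1 + V\<close> is represented both through the index 8 and
  through the index for \<open>a\<close>. Cross-multiplication shows that the root of
  \<open>Y\<close> is also a root of the explicit polynomial \<open>bessel_poly 8\<close> modulo 49,
  whatever \<open>a\<close> is.\<close>

lemma bessel_poly_root_mod_49:
  assumes a: "a \<ge> 2" and r: "7 ^ a dvd poly (bessel_poly (mod7_index a)) (int r)"
  shows "[r = 3] (mod 49)"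
proof -
  let ?Y = "bessel_poly (mod7_index a)" and ?P = "bessel_num (mod7_index a)"
  have "(7 :: int) ^ 2 dvd 7 ^ a" using a by (rule le_imp_power_dvd)
  then have m: "(49 :: int) dvd 7 ^ a" by simp
  have "fps_const 49 dvd ((1 + V) * fps_of_poly (bessel_poly 8) - fps_of_poly (bessel_num 8)) * fps_of_poly ?Y
      - ((1 + V) * fps_of_poly ?Y - fps_of_poly ?P) * fps_of_poly (bessel_poly 8)"
    using m by (intro dvd_diff[OF dvd_mult2 dvd_mult2] riccati_times_bessel) (simp_all add: mod7_index)
  also have "\<dots> = fps_of_poly (?P * bessel_poly 8 - bessel_num 8 * ?Y)"
    by (simp add: fps_of_poly_diff fps_of_poly_mult algebra_simps)
  finally have "49 dvd poly (?P * bessel_poly 8 - bessel_num 8 * ?Y) (int r)"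
    by (intro poly_dvd_of_const_dvd) (simp only: fps_const_dvd_fps_of_poly)
  moreover have Y49: "49 dvd poly ?Y (int r)" using m r by (rule dvd_trans)
  ultimately have m1: "7 ^ 2 dvd poly (bessel_poly 8) (int r) * poly ?P (int r)"
    by (simp add: mult.commute dvd_diff_left_iff dvd_diff_right_iff)
  have "7 dvd poly ?Y (int r)" using Y49 by (rule dvd_trans[rotated]) simp
  then have r7: "[int r = 3] (mod 7)" and P: "\<not> 7 dvd poly ?P (int r)"
    using bessel_num_root_not_dvd[of a "int r"] a by auto
  have "49 dvd poly (bessel_poly 8) (int r)"
    using prime_power_dvd_mult_cancel[OF _ m1 P] by simp
  moreover have "49 dvd int r mod 49 - int r" by (simp add: mod_eq_dvd_iff[symmetric])
  then have "49 dvd poly (bessel_poly 8) (int r mod 49) - poly (bessel_poly 8) (int r)"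
    using diff_dvd_poly_diff by (rule dvd_trans)
  ultimately have "49 dvd poly (bessel_poly 8) (int r mod 49)"
    by (simp add: dvd_diff_left_iff)
  moreover define m where "m = int r mod 49"
  ultimately have Y8: "49 dvd poly (bessel_poly 8) m" by simp
  have "m mod 7 = 3"
    using r7 by (simp add: cong_def m_def mod_mod_cancel)
  moreover have "0 \<le> m" "m < 49" by (simp_all add: m_def)
  \<comment> \<open>Of the seven lifts of 3 to residues modulo 49, evaluation leaves only 3
    itself.\<close>
  ultimately have "m = 3 \<or> m = 10 \<or> m = 17 \<or> m = 24 \<or> m = 31 \<or> m = 38 \<or> m = 45"
    by presburger
  then have "int r mod 49 = 3"
    using Y8 unfolding poly_bessel_8 m_def[symmetric] by (elim disjE) simp_all
  then have "[int r = int 3] (mod int 49)" by (simp add: cong_def)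
  then show ?thesis by (simp only: cong_int_iff)
qed

lemma mod_period_imp_dvd:
  assumes a: "a \<ge> 1" and q: "mod_period V a q"
  shows "6 * 7 ^ (a - 1) dvd q"
proof -
  obtain r where r: "7 ^ a dvd poly (bessel_poly (mod7_index a)) (int r)"
    using bessel_poly_root[OF a] by blast
  have "7 dvd poly (bessel_poly (mod7_index a)) (int r)"
    using dvd_trans[OF dvd_power[of a "7 :: int"] r] a by simp
  then have "[int r = int 3] (mod int 7)" using bessel_num_root_not_dvd[OF a] by simp
  then have "[r = 3] (mod 7)" by (simp only: cong_int_iff)
  then have 7: "residue_primroot 7 r"
    using residue_primroot_7_3 residue_primroot_cong by blast
  have "residue_primroot (7 ^ a) r"
  proof (cases "a = 1")
    case False
    then have "[r = 3] (mod 49)" using bessel_poly_root_mod_49[OF _ r] a by simp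
    \<comment> \<open>As \<open>3^6 = 729\<close> is 43 modulo 49, the sixth power is not 1 there.
      This is the criterion for a primitive root modulo 7 to remain one modulo all higher
      powers.\<close>
    then have "[r ^ 6 = 3 ^ 6] (mod 49)" by (rule cong_pow)
    then have "[r ^ (7 - 1) \<noteq> 1] (mod 7\<^sup>2)" by (simp add: cong_def)
    then show ?thesis using residue_primroot_prime_lift_iff[of 7 r] 7 a by simp
  qed (use 7 in simp)
  then have "ord (7 ^ a) r = 6 * 7 ^ (a - 1)"
    using a by (simp add: residue_primroot_def totient_prime_power)
  then show ?thesis
    using mod_period_imp_root_power[OF a r q] by (simp add: ord_divides')
qed

end

section \<open>From the counting recurrence to the Riccati equation and back to periods\<close>

lemma fps_XD_numeral_mult: "fps_XD (numeral k * A) = numeral k * fps_XD (A :: 'a :: comm_ring_1 fps)"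
  by (simp only: numeral_fps_const fps_XD_mult_const)

text \<open>The convolution says that \<open>V\<close> is \<open>6 z H' / H\<close>, and the
  recurrence is a linear equation of second order for \<open>H\<close>. Substituting the logarithmic
  derivative and cancelling \<open>H\<close> gives the Riccati equation.\<close>

lemma riccati_of_convolution:
  fixes h :: "nat \<Rightarrow> real" and a :: "nat \<Rightarrow> nat"
  assumes h0: "h 0 \<noteq> 0"
    and h: "\<And>l. 6 * real (Suc l) * h (Suc l) = (6 * real l + 1) * (6 * real l + 5) * h l"
    and conv: "\<And>l. l \<ge> 1 \<Longrightarrow> 6 * real l * h l = (\<Sum>k=1..l. a k * h (l - k))"
  defines "V \<equiv> Abs_fps (\<lambda>l. if l = 0 then 0 else int (a l))"
  shows "V = fps_X * (6 * fps_XD V + V\<^sup>2 + 6 * V + 5)"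
proof -
  \<comment> \<open>\<open>h\<close> need not be integral, so the computation takes place over the
    reals and is pulled back along the coefficientwise embedding.\<close>
  define \<iota> :: "int fps \<Rightarrow> real fps" where "\<iota> = (\<lambda>A. Abs_fps (\<lambda>n. real_of_int (fps_nth A n)))"
  have \<iota>_inj: "A = B" if "\<iota> A = \<iota> B" for A B
    using that by (auto simp: \<iota>_def fps_eq_iff)
  have \<iota>_num: "\<iota> (numeral k) = numeral k" for k
    by (auto simp: \<iota>_def fps_eq_iff numeral_fps_const)
  have \<iota>_X: "\<iota> fps_X = fps_X" by (auto simp: \<iota>_def fps_eq_iff fps_X_def)
  have \<iota>_add: "\<iota> (A + B) = \<iota> A + \<iota> B" for A B by (auto simp: \<iota>_def fps_eq_iff)
  have \<iota>_mult: "\<iota> (A * B) = \<iota> A * \<iota> B" for A B by (auto simp: \<iota>_def fps_eq_iff fps_mult_nth)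
  have \<iota>_XD: "\<iota> (fps_XD A) = fps_XD (\<iota> A)" for A by (auto simp: \<iota>_def fps_eq_iff fps_XD_nth)
  define W where "W = \<iota> V"
  define H where "H = Abs_fps h"
  have W_nth: "fps_nth W n = (if n = 0 then 0 else real (a n))" for n by (simp add: W_def \<iota>_def V_def)
  have WH: "W * H = 6 * fps_XD H"
  proof (rule fps_ext)
    fix n
    have "fps_nth (W * H) n = (\<Sum>k=0..n. fps_nth W k * h (n - k))" by (simp add: fps_mult_nth H_def)
    also have "\<dots> = (\<Sum>k=1..n. a k * h (n - k))"
      by (subst sum.atLeast_Suc_atMost) (auto simp: W_nth intro: sum.cong)
    also have "\<dots> = 6 * real n * h n" using conv[of n] by (cases "n = 0") auto
    finally show "fps_nth (W * H) n = fps_nth (6 * fps_XD H) n"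
      by (simp add: H_def fps_XD_nth numeral_fps_const)
  qed
  have ode: "6 * fps_XD H = fps_X * (36 * fps_XD (fps_XD H) + 36 * fps_XD H + 5 * H)"
  proof (rule fps_ext)
    fix n
    show "fps_nth (6 * fps_XD H) n = fps_nth (fps_X * (36 * fps_XD (fps_XD H) + 36 * fps_XD H + 5 * H)) n"
      using h[of "n - 1"] by (cases n) (simp_all add: H_def fps_XD_nth numeral_fps_const algebra_simps)
  qed
  have "6 * fps_XD (W * H) = 36 * fps_XD (fps_XD H)"
    unfolding WH by (simp add: fps_XD_numeral_mult)
  then have "36 * fps_XD (fps_XD H) = 6 * fps_XD W * H + W * (6 * fps_XD H)"
    by (simp add: fps_XD_mult algebra_simps)
  then have D2: "36 * fps_XD (fps_XD H) = 6 * fps_XD W * H + W * (W * H)"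
    unfolding WH .
  have "36 * fps_XD H = 6 * (W * H)" unfolding WH by simp
  then have "W * H = fps_X * (6 * fps_XD W * H + W * (W * H) + 6 * (W * H) + 5 * H)"
    using ode unfolding WH[symmetric] D2 by simp
  then have "W * H = fps_X * (6 * fps_XD W + W\<^sup>2 + 6 * W + 5) * H"
    by (simp add: algebra_simps power2_eq_square)
  moreover have "H \<noteq> 0" using h0 by (auto simp: H_def fps_eq_iff)
  ultimately have "W = fps_X * (6 * fps_XD W + W\<^sup>2 + 6 * W + 5)" by simp
  then have "\<iota> V = \<iota> (fps_X * (6 * fps_XD V + V\<^sup>2 + 6 * V + 5))"
    by (simp add: \<iota>_add \<iota>_mult \<iota>_num \<iota>_X \<iota>_XD W_def power2_eq_square)
  then show ?thesis by (rule \<iota>_inj)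
qed

lemma ultimate_period_iff:
  fixes f :: "nat \<Rightarrow> nat" and V :: "int fps"
  assumes V: "\<And>l. l \<ge> 1 \<Longrightarrow> fps_nth V l = int (f l)"
  shows "ultimate_period (\<lambda>n. f (Suc n) mod 7 ^ a) q \<longleftrightarrow> q > 0 \<and> mod_period V a q"
proof -
  \<comment> \<open>For \<open>n > q\<close> both indices \<open>n - q\<close> and \<open>n\<close>
    are positive, so the constant term of the series, which is not a count, does not enter.\<close>
  have nth: "7 ^ a dvd fps_nth ((1 + V) * (fps_X ^ q - 1)) n \<longleftrightarrow> f (n - q) mod 7 ^ a = f n mod 7 ^ a"
    if "n > q" for n
  proof -
    have "fps_nth ((1 + V) * (fps_X ^ q - 1)) n = int (f (n - q)) - int (f n)"
      using that by (simp add: right_diff_distrib fps_X_power_mult_right_nth V)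
    then have "7 ^ a dvd fps_nth ((1 + V) * (fps_X ^ q - 1)) n \<longleftrightarrow>
        int (f (n - q)) mod 7 ^ a = int (f n) mod 7 ^ a"
      by (simp only: mod_eq_dvd_iff)
    also have "\<dots> \<longleftrightarrow> int (f (n - q) mod 7 ^ a) = int (f n mod 7 ^ a)"
      by (simp only: zmod_int of_nat_power of_nat_numeral)
    finally show ?thesis by (simp only: of_nat_eq_iff)
  qed
  have "mod_period V a q \<longleftrightarrow> (\<exists>n0. \<forall>n\<ge>n0. 7 ^ a dvd fps_nth ((1 + V) * (fps_X ^ q - 1)) n)"
    unfolding mod_period_def by (rule fps_const_dvd_eventually_polynomial)
  also have "\<dots> \<longleftrightarrow> (\<exists>N. \<forall>n\<ge>N. f (Suc (n + q)) mod 7 ^ a = f (Suc n) mod 7 ^ a)"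
  proof
    assume "\<exists>n0. \<forall>n\<ge>n0. 7 ^ a dvd fps_nth ((1 + V) * (fps_X ^ q - 1)) n"
    then obtain n0 where n0: "\<And>n. n \<ge> n0 \<Longrightarrow> 7 ^ a dvd fps_nth ((1 + V) * (fps_X ^ q - 1)) n" by blast
    have "f (Suc (n + q)) mod 7 ^ a = f (Suc n) mod 7 ^ a" if "n \<ge> n0" for n
      using n0[of "Suc (n + q)"] nth[of "Suc (n + q)"] that by simp
    then show "\<exists>N. \<forall>n\<ge>N. f (Suc (n + q)) mod 7 ^ a = f (Suc n) mod 7 ^ a" by blast
  next
    assume "\<exists>N. \<forall>n\<ge>N. f (Suc (n + q)) mod 7 ^ a = f (Suc n) mod 7 ^ a"
    then obtain N where N: "\<And>n. n \<ge> N \<Longrightarrow> f (Suc (n + q)) mod 7 ^ a = f (Suc n) mod 7 ^ a" by blast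
    have "7 ^ a dvd fps_nth ((1 + V) * (fps_X ^ q - 1)) n" if "n \<ge> Suc (N + q)" for n
    proof -
      have "n = Suc ((n - q - 1) + q)" "n - q = Suc (n - q - 1)" using that by auto
      then show ?thesis using nth[of n] N[of "n - q - 1"] that by auto
    qed
    then show "\<exists>n0. \<forall>n\<ge>n0. 7 ^ a dvd fps_nth ((1 + V) * (fps_X ^ q - 1)) n" by blast
  qed
  finally show ?thesis by (auto simp: ultimate_period_def)
qed

theorem theorem12:
  fixes \<alpha> :: nat
  assumes "\<alpha> \<ge> 1"
  shows "(\<exists>P :: int poly.
            fps_coeffs_cong free_subgroup_fps
              (fps_quot (fps_of_poly P) ((1 + 2 * fps_X) ^ \<alpha>)) (7 ^ \<alpha>))
       \<and> ultimately_periodic (\<lambda>n. num_free_subgroups (Suc n) mod 7 ^ \<alpha>)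
       \<and> minimal_period (\<lambda>n. num_free_subgroups (Suc n) mod 7 ^ \<alpha>) = 6 * 7 ^ (\<alpha> - 1)"
proof -
  define V where "V = Abs_fps (\<lambda>l. if l = 0 then 0 else int (num_free_subgroups l))"
  define h where "h = (\<lambda>l. real (num_fpf_pairs (6 * l)) / fact (6 * l))"
  have "h 0 \<noteq> 0" by (simp add: h_def num_fpf_pairs_def)
  moreover have "6 * real (Suc l) * h (Suc l) = (6 * real l + 1) * (6 * real l + 5) * h l" for l
    unfolding h_def by (rule num_fpf_pairs_6)
  moreover have "6 * real l * h l = (\<Sum>k=1..l. num_free_subgroups k * h (l - k))" if "l \<ge> 1" for l
    unfolding h_def num_free_subgroups_eq by (rule PSL.num_fpf_pairs_convolution_6[OF that])
  ultimately have ric: "V = fps_X * (6 * fps_XD V + V\<^sup>2 + 6 * V + 5)"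
    unfolding V_def by (rule riccati_of_convolution)
  have F: "free_subgroup_fps = 1 + V"
    by (auto simp: free_subgroup_fps_def V_def fps_eq_iff)
  let ?s = "\<lambda>n. num_free_subgroups (Suc n) mod 7 ^ \<alpha>" and ?p = "6 * 7 ^ (\<alpha> - 1) :: nat"
  have period: "ultimate_period ?s q \<longleftrightarrow> q > 0 \<and> mod_period V \<alpha> q" for q
    by (rule ultimate_period_iff) (simp add: V_def)
  have p: "ultimate_period ?s ?p"
    using mod_period_6_7[OF ric assms] by (simp add: period)
  have "?p \<le> q" if "ultimate_period ?s q" for q
    using mod_period_imp_dvd[OF ric assms, of q] that by (auto simp: period intro: dvd_imp_le)
  with p have "minimal_period ?s = ?p"
    unfolding minimal_period_def by (intro Least_equality)
  moreover have "ultimately_periodic ?s"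
    using p by (auto simp: ultimately_periodic_def)
  moreover have "\<exists>P. fps_coeffs_cong free_subgroup_fps
      (fps_quot (fps_of_poly P) ((1 + 2 * fps_X) ^ \<alpha>)) (7 ^ \<alpha>)"
    unfolding F by (rule riccati_rational_mod_power_7[OF ric assms])
  ultimately show ?thesis by blast
qed

end
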